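(* Let $n>k\ge1$ be coprime integers, $\eta$ in the upper half-plane, $\Lambda=\mathbb{Z}+\mathbb{Z}\eta$, and $\tau\in\mathbb{C}\setminus\frac1n\Lambda$. Writing $R(z)=R_\tau(z)$, for all $u,v\in\mathbb{C}$, $$R(u)_{12}\,R(u+v)_{23}\,R(v)_{12}=R(v)_{23}\,R(u+v)_{12}\,R(u)_{23}$$ as operators on $V^{\otimes3}$, where $A_{12}=A\otimes I$ and $A_{23}=I\otimes A$ for $A\in\mathrm{End}(V\otimes V)$ and $I$ the identity of $V$.
   Context: Write $e(z)=e^{2\pi i z}$ and $\theta(z)=\sum_{m\in\mathbb{Z}}(-1)^m e\big(mz+\tfrac12 m(m-1)\eta\big)$. For $\alpha\in\mathbb{Z}$ put $\theta_\alpha(z)=e\big(\alpha z+\tfrac{\alpha}{2n}+\tfrac{\alpha(\alpha-n)}{2n}\eta\big)\prod_{m=0}^{n-1}\theta\big(z+\tfrac mn+\tfrac{\alpha}{n}\eta\big)$, regarded as indexed by $\alpha\in\mathbb{Z}_n$. Let $V$ be an $n$-dimensional complex vector space with basis $x_i$, $i\in\mathbb{Z}_n$. For $\tau\in\mathbb{C}\setminus\frac1n\Lambda$ and $z\in\mathbb{C}$, define $R_\tau(z)\in\mathrm{End}(V\otimes V)$ by $$R_\tau(z)(x_i\otimes x_j)=\frac{\theta_0(-z)\cdots\theta_{n-1}(-z)}{\theta_1(0)\cdots\theta_{n-1}(0)}\sum_{r\in\mathbb{Z}_n}\frac{\theta_{j-i+r(k-1)}(-z+\tau)}{\theta_{j-i-r}(-z)\,\theta_{kr}(\tau)}\,x_{j-r}\otimes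 x_{i+r}.$$ *)

theory Defs
  imports "HOL-Analysis.Analysis"
begin

definition ee :: "complex \<Rightarrow> complex" where
  "ee z = exp (2 * of_real pi * \<i> * z)"

definition jtheta :: "complex \<Rightarrow> complex \<Rightarrow> complex" where
  "jtheta \<eta> z = (\<Sum>\<^sub>\<infinity> m::int. (-1) powi m *
      ee (of_int m * z + of_int m * (of_int m - 1) / 2 * \<eta>))"

text \<open>theta_alpha(z), alpha an integer (it only depends on alpha mod n)\<close>
definition theta_idx :: "nat \<Rightarrow> complex \<Rightarrow> int \<Rightarrow> complex \<Rightarrow> complex" where
  "theta_idx n \<eta> \<alpha> z =
     ee (of_int \<alpha> * z + of_int \<alpha> / (2 * of_nat n)
         + of_int \<alpha> * (of_int \<alpha> - of_nat n) / (2 * of_nat n) * \<eta>)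
     * (\<Prod>m<n. jtheta \<eta> (z + of_nat m / of_nat n + of_int \<alpha> / of_nat n * \<eta>))"

text \<open>Index set Z_n, represented by the integers 0..n-1.\<close>
definition idx :: "nat \<Rightarrow> int set" where
  "idx n = {0..<int n}"

text \<open>Matrix coefficient of R_tau(z): Rmat ... z (a,b) (i,j) is the coefficient of
  x_a \<otimes> x_b in R_tau(z)(x_i \<otimes> x_j).  The quotient
  theta_0(-z)...theta_{n-1}(-z) / theta_{j-i-r}(-z) is written as the product of the
  remaining factors (the entire function it denotes).\<close>
definition Rmat :: "nat \<Rightarrow> int \<Rightarrow> complex \<Rightarrow> complex \<Rightarrow> complex \<Rightarrow> int \<times> int \<Rightarrow> int \<times> int \<Rightarrow> complex" where
  "Rmat n k \<eta> \<tau> z ab ij =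
     (let (a, b) = ab; (i, j) = ij in
      (1 / (\<Prod>\<beta>\<in>{1..<int n}. theta_idx n \<eta> \<beta> 0)) *
      (\<Sum>r\<in>{r\<in>idx n. (j - r) mod int n = a \<and> (i + r) mod int n = b}.
          (\<Prod>\<beta>\<in>idx n - {(j - i - r) mod int n}. theta_idx n \<eta> \<beta> (- z)) *
          theta_idx n \<eta> (j - i + r * (k - 1)) (- z + \<tau>) / theta_idx n \<eta> (k * r) \<tau>))"

text \<open>Operators on V\<otimes>V\<otimes>V as matrices indexed by basis triples (output, input).\<close>
definition op12 :: "(int \<times> int \<Rightarrow> int \<times> int \<Rightarrow> complex) \<Rightarrow> int \<times> int \<times> int \<Rightarrow> int \<times> int \<times> int \<Rightarrow> complex" where
  "op12 A x y = (let (a, b, c) = x; (i, j, l) = y in A (a, b) (i, j) * (if c = l then 1 else 0))"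

definition op23 :: "(int \<times> int \<Rightarrow> int \<times> int \<Rightarrow> complex) \<Rightarrow> int \<times> int \<times> int \<Rightarrow> int \<times> int \<times> int \<Rightarrow> complex" where
  "op23 A x y = (let (a, b, c) = x; (i, j, l) = y in (if a = i then 1 else 0) * A (b, c) (j, l))"

definition idx3 :: "nat \<Rightarrow> (int \<times> int \<times> int) set" where
  "idx3 n = idx n \<times> idx n \<times> idx n"

definition mmul :: "nat \<Rightarrow> (int \<times> int \<times> int \<Rightarrow> int \<times> int \<times> int \<Rightarrow> complex)
     \<Rightarrow> (int \<times> int \<times> int \<Rightarrow> int \<times> int \<times> int \<Rightarrow> complex)
     \<Rightarrow> int \<times> int \<times> int \<Rightarrow> int \<times> int \<times> int \<Rightarrow> complex" where
  "mmul n A B x y = (\<Sum>w\<in>idx3 n. A x w * B w y)"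

end

theory Submission
  imports Defs
begin

text \<open>
  The coefficients of \<open>R\<^sub>\<tau>(z)\<close> are Kronecker functions \<open>F(X, Y) = \<theta>(X + Y) / (\<theta>(X) \<theta>(Y))\<close>
  with \<open>X = (j - i - r, - z)\<close> and \<open>Y = (k r, \<tau>)\<close> in the group of pairs (index, complex number), so
  every matrix coefficient of either side is a sum over one index of products of three values of \<open>F\<close>.
  If the middle index of the output differs from that of the input, Fay's identity
  \<open>F(X\<^sub>1, Y\<^sub>1) F(X\<^sub>2, Y\<^sub>2) = F(X\<^sub>1 + X\<^sub>2, Y\<^sub>1) F(X\<^sub>2, Y\<^sub>2 - Y\<^sub>1) + F(X\<^sub>1 + X\<^sub>2, Y\<^sub>2) F(X\<^sub>1, Y\<^sub>1 - Y\<^sub>2)\<close>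
  applied to the two outer factors splits both sums into the same two sums. If the two indices agree,
  this identity degenerates; instead, \<open>F(X\<^sub>1, Y) F(X\<^sub>2, Y)\<close> depends on the splitting of
  \<open>X = X\<^sub>1 + X\<^sub>2\<close> only through a multiple, independent of \<open>Y\<close>, of \<open>F(X, Y)\<close>, which
  cancels in the difference of the two sides and leaves a sum that is antisymmetric under a
  reflection of the index.

  Both identities come from the three-term relation for theta functions, which is a Pluecker relation
  because \<open>\<theta>(x + y) \<theta>(x - y)\<close> is a \<open>2 \<times> 2\<close> determinant. The zeros of \<open>\<theta>\<close> and the
  relation of the products \<open>\<theta>\<^sub>\<alpha>\<close> to a single theta function of modulus \<open>n \<eta>\<close> follow from
  the product expansion of \<open>\<theta>\<close>, obtained as a limit of the \<open>q\<close>-binomial theorem. The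
  exceptional \<open>u, v\<close>, where some \<open>\<theta>\<^sub>\<alpha>\<close> vanishes, are reached by continuity.
\<close>

subsection \<open>The exponential function\<close>

lemma ee_add: "ee (x + y) = ee x * ee y"
  by (simp add: ee_def exp_add algebra_simps)

lemma ee_0 [simp]: "ee 0 = 1"
  by (simp add: ee_def)

lemma ee_nonzero [simp]: "ee x \<noteq> 0"
  by (simp add: ee_def)

lemma ee_diff: "ee (x - y) = ee x / ee y"
  by (simp add: ee_def exp_diff algebra_simps)

lemma ee_minus: "ee (- x) = inverse (ee x)"
  by (simp add: ee_def exp_minus)

lemma ee_of_int [simp]: "ee (of_int m) = 1"
  using exp_integer_2pi[of "of_int m"] by (simp add: ee_def mult_ac)

lemma ee_of_nat_mult: "ee (of_nat m * x) = ee x ^ m"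
  by (simp add: ee_def exp_of_nat_mult[symmetric] algebra_simps)

lemma ee_eq_1_iff: "ee x = 1 \<longleftrightarrow> x \<in> \<int>"
proof
  assume "ee x = 1"
  then obtain k :: int where "Re (2 * of_real pi * \<i> * x) = 0" "Im (2 * of_real pi * \<i> * x) = of_int (2 * k) * pi"
    by (auto simp: ee_def exp_eq_1)
  then have "x = of_int k" by (auto simp: complex_eq_iff)
  then show "x \<in> \<int>" by simp
qed (auto elim: Ints_cases)

lemma ee_half: "ee (1 / 2) = - 1"
proof -
  have "2 * complex_of_real pi * \<i> * (1/2) = of_real pi * \<i>" by simp
  then show ?thesis by (simp only: ee_def exp_pi_i)
qed

lemma norm_ee: "norm (ee x) = exp (- 2 * pi * Im x)"
  by (simp add: ee_def)

lemma continuous_on_ee [continuous_intros]: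
  "continuous_on S f \<Longrightarrow> continuous_on S (\<lambda>x. ee (f x))"
  unfolding ee_def by (intro continuous_intros)

lemma summable_exp_minus_abs: "(\<lambda>m::int. exp (- real_of_int \<bar>m\<bar>)) summable_on UNIV"
proof -
  have *: "(\<lambda>n::nat. exp (- real n)) summable_on UNIV"
  proof (rule norm_summable_imp_summable_on)
    have "(\<lambda>n. exp (- real n)) = (\<lambda>n. exp (-1) ^ n)"
      by (simp add: exp_of_nat_mult[symmetric])
    then show "summable (\<lambda>n. norm (exp (- real n)))"
      by (simp add: summable_geometric)
  qed
  have "(\<lambda>m::int. exp (- real_of_int \<bar>m\<bar>)) summable_on range int"
    using * by (subst summable_on_reindex) (auto simp: o_def)
  moreover have "(\<lambda>m::int. exp (- real_of_int \<bar>m\<bar>)) summable_on range (\<lambda>n. - int n)"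
    using * by (subst summable_on_reindex) (auto simp: o_def inj_def)
  moreover have "range int \<union> range (\<lambda>n. - int n) = UNIV"
    by (metis (no_types, lifting) UNIV_eq_I UnCI int_cases2 rangeI)
  ultimately show ?thesis
    by (metis summable_on_union)
qed

text \<open>Completing the square bounds \<open>- c * t^2 + R * t\<close> by a constant minus
  \<open>t\<close>, which reduces the series to a geometric one. This majorant serves both kinds of
  theta series below.\<close>

lemma summable_gaussian:
  assumes "0 < c"
  shows "(\<lambda>m::int. exp (- c * (real_of_int m)\<^sup>2 + R * real_of_int \<bar>m\<bar>)) summable_on UNIV"
proof (rule summable_on_comparison_test)
  show "(\<lambda>m::int. exp ((R + 1)\<^sup>2 / (4 * c)) * exp (- real_of_int \<bar>m\<bar>)) summable_on UNIV"
    by (intro summable_on_cmult_right summable_exp_minus_abs)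
next
  fix m :: int
  define t where "t = real_of_int \<bar>m\<bar>"
  have "0 \<le> (2 * c * t - (R + 1))\<^sup>2 / (4 * c)" using assms by simp
  also have "\<dots> = (R + 1)\<^sup>2 / (4 * c) - (R + 1) * t + c * t\<^sup>2"
    using assms by (simp add: field_simps power2_eq_square)
  finally have "- c * t\<^sup>2 + R * t \<le> (R + 1)\<^sup>2 / (4 * c) + - t"
    by (simp add: algebra_simps)
  then show "exp (- c * (real_of_int m)\<^sup>2 + R * real_of_int \<bar>m\<bar>) \<le> exp ((R + 1)\<^sup>2 / (4 * c)) * exp (- real_of_int \<bar>m\<bar>)"
    by (simp add: t_def exp_add[symmetric])
qed auto

subsection \<open>The theta series\<close>

definition jterm :: "complex \<Rightarrow> complex \<Rightarrow> int \<Rightarrow> complex" where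
  "jterm \<eta> z m = (-1) powi m * ee (of_int m * z + of_int m * (of_int m - 1) / 2 * \<eta>)"

lemma jtheta_eq_infsum_jterm: "jtheta \<eta> z = (\<Sum>\<^sub>\<infinity>m. jterm \<eta> z m)"
  by (simp add: jtheta_def jterm_def)

text \<open>The bound depends on \<open>z\<close> only through the width \<open>R\<close> of the
  strip, so it can serve as majorant in the Weierstrass M-test. The linear part of m (m - 1) / 2
  contributes \<open>pi * Im \<eta>\<close> to the coefficient of
  \<open>\<bar>m\<bar>\<close>.\<close>

lemma norm_jterm_le:
  assumes "0 < Im \<eta>" "\<bar>Im z\<bar> \<le> R"
  shows "norm (jterm \<eta> z m)
    \<le> exp (- (pi * Im \<eta>) * (real_of_int m)\<^sup>2 + (pi * Im \<eta> + 2 * pi * R) * real_of_int \<bar>m\<bar>)"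
proof -
  have "Im (of_int m * z + of_int m * (of_int m - 1) / 2 * \<eta>) = m * Im z + real_of_int m * (real_of_int m - 1) / 2 * Im \<eta>"
    by (simp add: Im_divide_numeral)
  then have "norm (jterm \<eta> z m) = exp (- 2 * pi * (m * Im z + real_of_int m * (real_of_int m - 1) / 2 * Im \<eta>))"
    by (simp add: jterm_def norm_mult norm_power_int norm_ee)
  also have "\<dots> \<le> exp (- (pi * Im \<eta>) * (real_of_int m)\<^sup>2 + (pi * Im \<eta> + 2 * pi * R) * real_of_int \<bar>m\<bar>)"
  proof -
    have "- (m * Im z) \<le> \<bar>real_of_int m * Im z\<bar>"
      by (rule abs_ge_minus_self)
    also have "\<dots> \<le> \<bar>m\<bar> * R"
      using assms(2) by (simp add: abs_mult mult_left_mono)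
    finally have 1: "- 2 * pi * (m * Im z) \<le> 2 * pi * R * \<bar>m\<bar>"
      using mult_left_mono[of "- (m * Im z)" "\<bar>m\<bar> * R" "2 * pi"] by (simp add: algebra_simps)
    have 2: "pi * Im \<eta> * m \<le> pi * Im \<eta> * \<bar>m\<bar>"
      using assms by (intro mult_left_mono) auto
    have eq: "- 2 * pi * (m * Im z + real_of_int m * (real_of_int m - 1) / 2 * Im \<eta>)
        = - 2 * pi * (m * Im z) + pi * Im \<eta> * m - (pi * Im \<eta>) * (real_of_int m)\<^sup>2"
      by (simp add: field_simps power2_eq_square)
    have "a + c - e * f \<le> - e * f + (d + b)" if "a \<le> b" "c \<le> d" for a b c d e f :: real
      using that by simp
    from this[OF 1 2] show ?thesis unfolding exp_le_cancel_iff eq distrib_right .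
  qed
  finally show ?thesis .
qed

lemma abs_summable_jterm:
  assumes "0 < Im \<eta>"
  shows "(\<lambda>m. norm (jterm \<eta> z m)) summable_on UNIV"
  by (rule summable_on_comparison_test[OF summable_gaussian[of "pi * Im \<eta>" "pi * Im \<eta> + 2 * pi * \<bar>Im z\<bar>"]])
     (use assms norm_jterm_le[OF assms order_refl] in auto)

lemma has_sum_jtheta:
  assumes "0 < Im \<eta>"
  shows "(jterm \<eta> z has_sum jtheta \<eta> z) UNIV"
  unfolding jtheta_eq_infsum_jterm
  using abs_summable_summable[OF abs_summable_jterm[OF assms]] by simp

text \<open>The series converges uniformly on every horizontal strip, and the open strips cover the
  plane.\<close>

lemma continuous_on_jtheta_UNIV:
  assumes "0 < Im \<eta>"
  shows "continuous_on UNIV (jtheta \<eta>)"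
proof -
  have "continuous_on {z. \<bar>Im z\<bar> < R} (jtheta \<eta>)" for R
  proof (rule uniform_limit_theorem)
    show "uniform_limit {z. \<bar>Im z\<bar> < R} (\<lambda>X z. \<Sum>m\<in>X. jterm \<eta> z m) (jtheta \<eta>)
        (finite_subsets_at_top UNIV)"
      by (rule Weierstrass_m_test_general'[OF norm_jterm_le[of _ _ R] has_sum_jtheta summable_gaussian])
         (use assms in auto)
    show "\<forall>\<^sub>F X in finite_subsets_at_top UNIV. continuous_on {z. \<bar>Im z\<bar> < R} (\<lambda>z. \<Sum>m\<in>X. jterm \<eta> z m)"
      unfolding jterm_def by (intro always_eventually allI continuous_intros)
  qed simp
  moreover have "open {z. \<bar>Im z\<bar> < R}" for R
    by (intro open_Collect_less continuous_intros)
  ultimately have "continuous_on (\<Union>R. {z. \<bar>Im z\<bar> < R}) (jtheta \<eta>)"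
    by (intro continuous_on_open_UN) auto
  moreover have "(\<Union>R. {z. \<bar>Im z\<bar> < R}) = UNIV"
    by (auto intro: gt_ex)
  ultimately show ?thesis by simp
qed

text \<open>Absolute convergence turns a product of two series into one sum over pairs, whose terms
  may then be regrouped freely.\<close>

lemma has_sum_product:
  fixes f :: "'a \<Rightarrow> complex" and g :: "'b \<Rightarrow> complex"
  assumes f: "(\<lambda>a. norm (f a)) summable_on A" "(f has_sum S) A"
    and g: "(\<lambda>b. norm (g b)) summable_on B" "(g has_sum T) B"
  shows "((\<lambda>(a, b). f a * g b) has_sum S * T) (A \<times> B)"
proof (rule has_sum_SigmaI)
  show "((\<lambda>b. case (a, b) of (a, b) \<Rightarrow> f a * g b) has_sum f a * T) B" for a
    using g(2) by (auto intro: has_sum_cmult_right)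
  show "((\<lambda>a. f a * T) has_sum S * T) A"
    using f(2) by (rule has_sum_cmult_left)
  have "(\<lambda>p. norm (case p of (a, b) \<Rightarrow> f a * g b)) summable_on A \<times> B"
    unfolding Infinite_Sum.abs_summable_on_Sigma_iff
  proof (intro conjI ballI)
    show "(\<lambda>y. norm (case (x, y) of (a, b) \<Rightarrow> f a * g b)) summable_on B" for x
      by (simp add: norm_mult summable_on_cmult_right[OF g(1)])
    have "(\<Sum>\<^sub>\<infinity>y\<in>B. norm (case (x, y) of (a, b) \<Rightarrow> f a * g b))
        = norm (f x) * (\<Sum>\<^sub>\<infinity>y\<in>B. norm (g y))" for x
      by (simp add: norm_mult infsum_cmult_right')
    then show "(\<lambda>x. norm (\<Sum>\<^sub>\<infinity>y\<in>B. norm (case (x, y) of (a, b) \<Rightarrow> f a * g b))) summable_on A"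
      by (simp add: abs_mult summable_on_cmult_left[OF f(1)])
  qed
  then show "(\<lambda>(a, b). f a * g b) summable_on A \<times> B"
    by (rule abs_summable_summable)
qed

text \<open>The reflection of \<open>m\<close> to \<open>1 - m\<close> preserves m (m - 1) / 2,
  flips the sign (-1)^m and shifts the linear exponent by \<open>- z\<close>.\<close>

lemma jtheta_minus:
  assumes "0 < Im \<eta>"
  shows "jtheta \<eta> (- z) = - ee (- z) * jtheta \<eta> z"
proof -
  have "((\<lambda>m. - ee (- z) * jterm \<eta> z m) has_sum - ee (- z) * jtheta \<eta> z) UNIV"
    by (intro has_sum_cmult_right has_sum_jtheta assms)
  also have "?this \<longleftrightarrow> (jterm \<eta> (- z) has_sum - ee (- z) * jtheta \<eta> z) UNIV"
  proof (rule has_sum_reindex_bij_witness[of _ "\<lambda>m. 1 - m" "\<lambda>m. 1 - m"])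
    fix m :: int
    have "of_int (1 - m) * (- z) + of_int (1 - m) * (of_int (1 - m) - 1) / 2 * \<eta>
        = - z + (of_int m * z + of_int m * (of_int m - 1) / 2 * \<eta>)"
      by (simp add: algebra_simps)
    moreover have "(-1 :: complex) powi (1 - m) = - ((-1) powi m)"
      by (simp add: power_int_diff power_int_minus_left)
    ultimately show "jterm \<eta> (- z) (1 - m) = - ee (- z) * jterm \<eta> z m"
      by (simp only: jterm_def ee_add) simp
  qed auto
  finally show ?thesis
    using has_sum_jtheta[OF assms, of "- z"] has_sum_unique by blast
qed

text \<open>Adding \<open>\<eta>\<close> to the argument amounts to a shift of the summation index
  by one.\<close>

lemma jtheta_plus_period:
  assumes "0 < Im \<eta>"
  shows "jtheta \<eta> (z + \<eta>) = - ee (- z) * jtheta \<eta> z"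
proof -
  have "((\<lambda>m. - ee (- z) * jterm \<eta> z m) has_sum - ee (- z) * jtheta \<eta> z) UNIV"
    by (intro has_sum_cmult_right has_sum_jtheta assms)
  also have "?this \<longleftrightarrow> (jterm \<eta> (z + \<eta>) has_sum - ee (- z) * jtheta \<eta> z) UNIV"
  proof (rule has_sum_reindex_bij_witness[of _ "\<lambda>m. m + 1" "\<lambda>m. m - 1"])
    fix m :: int
    have "of_int (m - 1) * (z + \<eta>) + of_int (m - 1) * (of_int (m - 1) - 1) / 2 * \<eta>
        = - z + (of_int m * z + of_int m * (of_int m - 1) / 2 * \<eta>)"
      by (simp add: field_simps)
    moreover have "(-1 :: complex) powi (m - 1) = - ((-1) powi m)"
      by (simp add: power_int_diff)
    ultimately show "jterm \<eta> (z + \<eta>) (m - 1) = - ee (- z) * jterm \<eta> z m"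
      by (simp only: jterm_def ee_add) simp
  qed auto
  finally show ?thesis
    using has_sum_jtheta[OF assms, of "z + \<eta>"] has_sum_unique by blast
qed

section \<open>Product formula for two theta values\<close>

definition psi :: "complex \<Rightarrow> complex \<Rightarrow> int \<Rightarrow> complex" where
  "psi \<eta> y m = ee (of_int m * y + (of_int m)\<^sup>2 / 4 * \<eta>)"

lemma abs_summable_psi:
  assumes "0 < Im \<eta>"
  shows "(\<lambda>m. norm (psi \<eta> y m)) summable_on A"
proof (rule summable_on_subset)
  show "(\<lambda>m. norm (psi \<eta> y m)) summable_on UNIV"
  proof (rule summable_on_comparison_test[OF summable_gaussian[of "pi / 2 * Im \<eta>" "2 * pi * \<bar>Im y\<bar>"]])
    fix m :: int
    have "Im (of_int m * y + (of_int m)\<^sup>2 / 4 * \<eta>) = m * Im y + m\<^sup>2 / 4 * Im \<eta>"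
      by (simp add: Im_divide_numeral power2_eq_square)
    moreover have "- (m * Im y) \<le> \<bar>m\<bar> * \<bar>Im y\<bar>"
      using abs_ge_minus_self[of "real_of_int m * Im y"] by (simp add: abs_mult)
    then have "- 2 * pi * (m * Im y) \<le> 2 * pi * \<bar>Im y\<bar> * \<bar>m\<bar>"
      using mult_left_mono[of "- (m * Im y)" "\<bar>m\<bar> * \<bar>Im y\<bar>" "2 * pi"] by (simp add: algebra_simps)
    ultimately show "norm (psi \<eta> y m)
        \<le> exp (- (pi / 2 * Im \<eta>) * (real_of_int m)\<^sup>2 + 2 * pi * \<bar>Im y\<bar> * real_of_int \<bar>m\<bar>)"
      by (simp add: psi_def norm_ee algebra_simps)
  qed (use assms in auto)
qed simp

text \<open>Writing m = 2 l or m = 2 l + 1 shows the two parity classes to be the theta functions of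
  level two: the sum of e(2 l y + l^2 \<eta>) and the same sum with l + 1/2 in place of l.\<close>

definition psi_sum :: "complex \<Rightarrow> bool \<Rightarrow> complex \<Rightarrow> complex" where
  "psi_sum \<eta> b y = (\<Sum>\<^sub>\<infinity>m\<in>{m. even m = b}. psi \<eta> y m)"

lemma has_sum_psi_sum:
  assumes "0 < Im \<eta>"
  shows "(psi \<eta> y has_sum psi_sum \<eta> b y) {m. even m = b}"
  unfolding psi_sum_def
  using abs_summable_summable[OF abs_summable_psi[OF assms]] by simp

text \<open>Expanding the double series in \<open>s = m + l\<close> and \<open>d = m - l\<close>, which have equal parity, gives one
  term of the determinant for each parity.\<close>
lemma jtheta_product:
  assumes "0 < Im \<eta>"
  shows "jtheta \<eta> (x + y) * jtheta \<eta> (x - y)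
    = ee (x - \<eta> / 4) * (psi_sum \<eta> False x * psi_sum \<eta> True y - psi_sum \<eta> True x * psi_sum \<eta> False y)"
    (is "_ = ?R")
proof -
  \<comment> \<open>The summand in the coordinates (s, d). Completing the square in s leaves the
    factor \<open>ee (x - \<eta> / 4)\<close> and moves the index to \<open>s - 1\<close>, so the
    series in \<open>x\<close> and in \<open>y\<close> run over opposite parities.\<close>
  define h where "h = (\<lambda>(s::int, d). (-1) powi s * ee (x - \<eta> / 4) * psi \<eta> x (s - 1) * psi \<eta> y d)"
  have shift: "((\<lambda>s. psi \<eta> x (s - 1)) has_sum psi_sum \<eta> (\<not> b) x) {s. even s = b}" for b
  proof -
    have "((\<lambda>s. psi \<eta> x (s - 1)) has_sum psi_sum \<eta> (\<not> b) x) {s. even s = b}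
      \<longleftrightarrow> (psi \<eta> x has_sum psi_sum \<eta> (\<not> b) x) {s. even s = (\<not> b)}"
      by (rule has_sum_reindex_bij_witness[of _ "\<lambda>s. s + 1" "\<lambda>s. s - 1"]) auto
    then show ?thesis using has_sum_psi_sum[OF assms] by blast
  qed
  have shift': "(\<lambda>s. norm (psi \<eta> x (s - 1))) summable_on {s. even s = b}" for b
  proof -
    have "(\<lambda>s. norm (psi \<eta> x (s - 1))) summable_on {s. even s = b}
      \<longleftrightarrow> (\<lambda>s. norm (psi \<eta> x s)) summable_on {s. even s = (\<not> b)}"
      by (rule summable_on_reindex_bij_witness[of _ "\<lambda>s. s + 1" "\<lambda>s. s - 1"]) auto
    then show ?thesis using abs_summable_psi[OF assms] by blast
  qed
  have block: "(h has_sum (if b then 1 else -1) * ee (x - \<eta> / 4) * (psi_sum \<eta> (\<not> b) x * psi_sum \<eta> b y))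
      ({s. even s = b} \<times> {d. even d = b})" for b
  proof -
    have "((\<lambda>p. (if b then 1 else -1) * ee (x - \<eta> / 4) * (case p of (s, d) \<Rightarrow> psi \<eta> x (s - 1) * psi \<eta> y d))
      has_sum (if b then 1 else -1) * ee (x - \<eta> / 4) * (psi_sum \<eta> (\<not> b) x * psi_sum \<eta> b y))
      ({s. even s = b} \<times> {d. even d = b})"
      by (intro has_sum_cmult_right has_sum_product shift shift' has_sum_psi_sum abs_summable_psi assms)
    then show ?thesis
      by (rule has_sum_cong[THEN iffD1, rotated]) (auto simp: h_def power_int_minus_left)
  qed
  have "(h has_sum ?R) ({s. even s = True} \<times> {d. even d = True} \<union> {s. even s = False} \<times> {d. even d = False})"
    using has_sum_Un_disjoint[OF block[of True] block[of False]] by (auto simp: algebra_simps)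
  also have "{s. even s = True} \<times> {d. even d = True} \<union> {s. even s = False} \<times> {d. even d = False}
    = {(s, d). even (s - d :: int)}" by auto
  finally have "(h has_sum ?R) {(s, d). even (s - d)}" .
  also have "?this \<longleftrightarrow> ((\<lambda>(m, l). jterm \<eta> (x + y) m * jterm \<eta> (x - y) l) has_sum ?R) (UNIV \<times> UNIV)"
  proof (rule has_sum_reindex_bij_witness[of _ "\<lambda>(m, l). (m + l, m - l)" "\<lambda>(s, d). ((s + d) div 2, (s - d) div 2)"])
    fix p :: "int \<times> int" assume "p \<in> {(s, d). even (s - d)}"
    then obtain s d where p: "p = (s, d)" "even (s - d)" by auto
    from p(2) obtain l where l: "s - d = 2 * l" by (rule evenE)
    define m where "m = d + l"
    have s: "s = m + l" "d = m - l" using l by (auto simp: m_def)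
    have "of_int m * (x + y) + of_int m * (of_int m - 1) / 2 * \<eta>
        + (of_int l * (x - y) + of_int l * (of_int l - 1) / 2 * \<eta>)
      = (x - \<eta> / 4) + (of_int (s - 1) * x + (of_int (s - 1))\<^sup>2 / 4 * \<eta>)
        + (of_int d * y + (of_int d)\<^sup>2 / 4 * \<eta>)"
      unfolding s by (simp add: field_simps power2_eq_square)
    then have "jterm \<eta> (x + y) m * jterm \<eta> (x - y) l = h (s, d)"
      unfolding h_def jterm_def psi_def
      by (simp add: ee_add[symmetric] s power_int_add add.assoc)
    then show "(case (case p of (s, d) \<Rightarrow> ((s + d) div 2, (s - d) div 2)) of
        (m, l) \<Rightarrow> jterm \<eta> (x + y) m * jterm \<eta> (x - y) l) = h p"
      by (simp add: p s)
  qed (auto, presburger)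
  finally have "((\<lambda>(m, l). jterm \<eta> (x + y) m * jterm \<eta> (x - y) l) has_sum ?R) (UNIV \<times> UNIV)" .
  moreover have "((\<lambda>(m, l). jterm \<eta> (x + y) m * jterm \<eta> (x - y) l)
      has_sum jtheta \<eta> (x + y) * jtheta \<eta> (x - y)) (UNIV \<times> UNIV)"
    by (intro has_sum_product has_sum_jtheta abs_summable_jterm assms)
  ultimately show ?thesis using has_sum_unique by blast
qed

subsection \<open>Product expansion and zeros\<close>

definition qfac :: "complex \<Rightarrow> nat \<Rightarrow> complex" where
  "qfac q M = (\<Prod>j<M. 1 - q * q ^ j)"

text \<open>The Gaussian binomial coefficient, as a quotient of the Pochhammer products (q; q)_M;
  the value 0 for k > M lets the Pascal rule cover the boundary.\<close>

definition qbin :: "complex \<Rightarrow> nat \<Rightarrow> nat \<Rightarrow> complex" where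
  "qbin q M k = (if k \<le> M then qfac q M / (qfac q k * qfac q (M - k)) else 0)"

lemma power_neq_1_of_norm_less:
  fixes q :: complex
  assumes "norm q < 1"
  shows "q * q ^ j \<noteq> 1"
proof -
  have "norm q * norm q ^ j \<le> norm q * 1"
    using assms by (intro mult_left_mono power_le_one) auto
  then have "norm (q * q ^ j) < 1"
    unfolding norm_mult norm_power using assms by linarith
  then show ?thesis by (metis norm_one less_irrefl)
qed

lemma qfac_nonzero: "norm q < 1 \<Longrightarrow> qfac q M \<noteq> 0"
  by (simp add: qfac_def) (metis power_neq_1_of_norm_less)

lemma qfac_Suc: "qfac q (Suc M) = qfac q M * (1 - q ^ Suc M)"
  by (simp add: qfac_def)

text \<open>The q-Pascal rule comes from 1 - q^(M+1) = (1 - q^(d+1)) + q^(d+1) (1 - q^(k+1)) with d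
  + 1 = M - k. For k = M the first term on the right is the value 0 outside the range.\<close>

lemma qbin_Suc_Suc:
  assumes "norm q < 1" "k \<le> M"
  shows "qbin q (Suc M) (Suc k) = qbin q M (Suc k) + q ^ (M - k) * qbin q M k"
proof (cases "k = M")
  case True
  then show ?thesis using qfac_nonzero[OF assms(1)] by (simp add: qbin_def)
next
  case False
  then have k: "k < M" using assms by simp
  then obtain d where d: "M - k = Suc d" "M - Suc k = d"
    by (metis Suc_diff_Suc)
  have M: "Suc M = Suc k + Suc d" using k d by simp
  have nz: "qfac q k \<noteq> 0" "qfac q d \<noteq> 0" "qfac q M \<noteq> 0" "1 - q ^ Suc k \<noteq> 0" "1 - q ^ Suc d \<noteq> 0"
    using qfac_nonzero[OF assms(1)] power_neq_1_of_norm_less[OF assms(1)] by auto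
  have "q ^ Suc M = q ^ Suc k * q ^ Suc d"
    unfolding M by (rule power_add)
  then have "1 - q ^ Suc M = (1 - q ^ Suc d) + q ^ Suc d * (1 - q ^ Suc k)"
    by (simp only:) (simp add: algebra_simps)
  then have "qbin q (Suc M) (Suc k) =
      qfac q M * ((1 - q ^ Suc d) + q ^ Suc d * (1 - q ^ Suc k)) / (qfac q (Suc k) * qfac q (Suc d))"
    using k d by (simp add: qbin_def qfac_Suc)
  also have "\<dots> = qfac q M / (qfac q (Suc k) * qfac q d) + q ^ Suc d * (qfac q M / (qfac q k * qfac q (Suc d)))"
    unfolding qfac_Suc using nz by (simp add: add_divide_distrib distrib_left mult_ac del: power_Suc)
  also have "\<dots> = qbin q M (Suc k) + q ^ (M - k) * qbin q M k"
    using k d by (simp add: qbin_def)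
  finally show ?thesis .
qed

text \<open>Induction on \<open>M\<close>: since (k+1 choose 2) + (M - k) = M + (k choose 2), the
  q-Pascal rule becomes multiplication by the new factor \<open>1 + q ^ M * y\<close>.\<close>

lemma q_binomial_theorem:
  assumes "norm q < 1"
  shows "(\<Prod>j<M. 1 + q ^ j * y) = (\<Sum>k\<le>M. q ^ (k choose 2) * qbin q M k * y ^ k)"
proof (induction M)
  case 0
  then show ?case by (simp add: qbin_def numeral_2_eq_2 qfac_def)
next
  case (Suc M)
  define d where "d = (\<lambda>M k. q ^ (k choose 2) * qbin q M k * y ^ k)"
  have d0: "d M 0 = 1" for M
    using qfac_nonzero[OF assms] by (simp add: d_def qbin_def numeral_2_eq_2 qfac_def)
  have step: "d (Suc M) (Suc k) = d M (Suc k) + q ^ M * y * d M k" if "k \<le> M" for k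
  proof -
    have "q ^ (Suc k choose 2) * q ^ (M - k) = q ^ M * q ^ (k choose 2)"
      using that by (simp add: numeral_2_eq_2 power_add[symmetric] add.commute)
    then show ?thesis
      unfolding d_def qbin_Suc_Suc[OF assms that]
      by (simp add: distrib_left distrib_right mult_ac)
  qed
  have "(\<Sum>k\<le>Suc M. d (Suc M) k) = 1 + (\<Sum>k\<le>M. d M (Suc k)) + q ^ M * y * (\<Sum>k\<le>M. d M k)"
    by (simp only: sum.atMost_Suc_shift d0) (simp add: step sum.distrib sum_distrib_left add.assoc)
  also have "1 + (\<Sum>k\<le>M. d M (Suc k)) = (\<Sum>k\<le>Suc M. d M k)"
    by (simp only: sum.atMost_Suc_shift d0)
  also have "\<dots> = (\<Sum>k\<le>M. d M k)"
    by (simp add: d_def qbin_def)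
  also have "\<dots> = (\<Prod>j<M. 1 + q ^ j * y)"
    unfolding Suc.IH d_def ..
  also have "(\<Prod>j<M. 1 + q ^ j * y) + q ^ M * y * (\<Prod>j<M. 1 + q ^ j * y) = (\<Prod>j<Suc M. 1 + q ^ j * y)"
    by (simp add: algebra_simps)
  finally show ?case
    unfolding d_def by (rule sym)
qed

section \<open>The finite Jacobi triple product and its limit\<close>

definition theta_partial :: "complex \<Rightarrow> complex \<Rightarrow> nat \<Rightarrow> complex" where
  "theta_partial q x N = (\<Prod>j<N. 1 - x * q ^ j) * (\<Prod>j<N. 1 - q / x * q ^ j)"

lemma ee_choose_2: "ee \<eta> ^ (k choose 2) = ee (of_nat k * (of_nat k - 1) / 2 * \<eta>)"
proof (induction k)
  case (Suc k)
  have "of_nat (Suc k) * (of_nat (Suc k) - 1) / 2 * \<eta> = of_nat k * \<eta> + of_nat k * (of_nat k - 1) / 2 * \<eta>"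
    by (simp add: field_simps)
  moreover have "ee \<eta> ^ (Suc k choose 2) = ee \<eta> ^ k * ee \<eta> ^ (k choose 2)"
    by (simp add: numeral_2_eq_2 power_add)
  ultimately show ?case by (simp only: Suc ee_add ee_of_nat_mult)
qed (simp add: numeral_2_eq_2)

text \<open>The q-binomial theorem with 2 N factors at y = - x / q^N: the upper N factors are 1 - x
  q^j, and the lower N, read backwards, are 1 - q^(j+1) / x up to monomials. The summation index is
  centred by m = k - N.\<close>

lemma finite_jacobi_triple:
  assumes "0 < Im \<eta>"
  shows "theta_partial (ee \<eta>) (ee z) N = (\<Sum>m\<in>{- int N..int N}. qbin (ee \<eta>) (2 * N) (nat (m + int N)) * jterm \<eta> z m)"
proof -
  define q where "q = ee \<eta>"
  define x where "x = ee z"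
  have q1: "norm q < 1" using assms by (simp add: q_def norm_ee)
  have nz: "q \<noteq> 0" "x \<noteq> 0" by (simp_all add: q_def x_def)
  define y where "y = - x / q ^ N"
  have set: "{..<2 * N} = {..<N} \<union> {N..<2 * N}" by auto
  have "(\<Prod>j<2 * N. 1 + q ^ j * y) = (\<Prod>j<N. 1 + q ^ j * y) * (\<Prod>j=N..<2 * N. 1 + q ^ j * y)"
    unfolding set by (rule prod.union_disjoint) auto
  also have "(\<Prod>j=N..<2 * N. 1 + q ^ j * y) = (\<Prod>j<N. 1 + q ^ (j + N) * y)"
    using prod.shift_bounds_nat_ivl[of "\<lambda>j. 1 + q ^ j * y" 0 N N]
    by (simp add: mult_2 atLeast0LessThan)
  also have "\<dots> = (\<Prod>j<N. 1 - x * q ^ j)"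
    using nz by (simp add: y_def power_add mult_ac)
  also have "(\<Prod>j<N. 1 + q ^ j * y) = (\<Prod>j<N. 1 + q ^ (N - Suc j) * y)"
    by (rule prod.nat_diff_reindex[symmetric])
  also have "\<dots> = (\<Prod>j<N. (- x / q ^ Suc j) * (1 - q / x * q ^ j))"
  proof (rule prod.cong)
    fix j assume "j \<in> {..<N}"
    then have qN: "q ^ N = q ^ (N - Suc j) * q ^ Suc j"
      by (simp only: power_add[symmetric]) simp
    have "1 + q ^ (N - Suc j) * y = 1 - x / q ^ Suc j"
      unfolding y_def qN using nz by simp
    also have "\<dots> = (- x / q ^ Suc j) * (1 - q ^ Suc j / x)"
      using nz by (simp add: right_diff_distrib del: power_Suc)
    finally show "1 + q ^ (N - Suc j) * y = (- x / q ^ Suc j) * (1 - q / x * q ^ j)"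
      by simp
  qed simp
  also have "\<dots> = (\<Prod>j<N. - x / q ^ Suc j) * (\<Prod>j<N. 1 - q / x * q ^ j)"
    by (rule prod.distrib)
  \<comment> \<open>The exponents 1, ..., N add up to (N+1 choose 2).\<close>
  also have "(\<Prod>j<N. - x / q ^ Suc j) = (- x) ^ N / q ^ (Suc N choose 2)"
  proof (induction N)
    case (Suc N)
    have "q ^ (Suc (Suc N) choose 2) = q ^ (Suc N choose 2) * q ^ Suc N"
      by (simp add: numeral_2_eq_2 power_add)
    then show ?case
      unfolding prod.lessThan_Suc Suc.IH by simp
  qed (simp add: numeral_2_eq_2)
  finally have *: "(\<Prod>j<2 * N. 1 + q ^ j * y) = (- x) ^ N / q ^ (Suc N choose 2) * theta_partial q x N"
    by (simp add: theta_partial_def mult_ac)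
  have "theta_partial q x N = q ^ (Suc N choose 2) / (- x) ^ N * (\<Prod>j<2 * N. 1 + q ^ j * y)"
    unfolding * using nz by simp
  also have "\<dots> = (\<Sum>k\<le>2 * N. q ^ (Suc N choose 2) / (- x) ^ N * (q ^ (k choose 2) * qbin q (2 * N) k * y ^ k))"
    unfolding q_binomial_theorem[OF q1] sum_distrib_left ..
  also have "\<dots> = (\<Sum>m\<in>{- int N..int N}. qbin q (2 * N) (nat (m + int N)) * jterm \<eta> z m)"
  proof (rule sum.reindex_bij_witness[of _ "\<lambda>m. nat (m + int N)" "\<lambda>k. int k - int N"])
    fix k assume "k \<in> {..2 * N}"
    have sgn: "(-1 :: complex) powi (int k - int N) = (-1) ^ k / (-1) ^ N"
      by (simp add: power_int_diff)
    \<comment> \<open>The quadratic exponent splits by (k - N)(k - N - 1) / 2 = (k choose 2) + (N+1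
      choose 2) - N k; the last term is supplied by \<open>y ^ k\<close>.\<close>
    have arg: "of_int (int k - int N) * z + of_int (int k - int N) * (of_int (int k - int N) - 1) / 2 * \<eta>
        = (of_nat k * z + of_nat (Suc N) * (of_nat (Suc N) - 1) / 2 * \<eta> + of_nat k * (of_nat k - 1) / 2 * \<eta>)
          - (of_nat N * z + of_nat (N * k) * \<eta>)"
      by (simp add: field_simps)
    have yk: "y ^ k = (-1) ^ k * x ^ k / q ^ (N * k)"
      unfolding y_def power_divide power_minus[of x] by (simp add: power_mult)
    have "jterm \<eta> z (int k - int N) = (-1) ^ k / (-1) ^ N
        * (x ^ k * q ^ (Suc N choose 2) * q ^ (k choose 2) / (x ^ N * q ^ (N * k)))"
      unfolding jterm_def sgn arg unfolding x_def q_def ee_choose_2 unfolding ee_of_nat_mult[symmetric]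
      by (simp only: ee_add ee_diff)
    then show "qbin q (2 * N) (nat (int k - int N + int N)) * jterm \<eta> z (int k - int N) =
        q ^ (Suc N choose 2) / (- x) ^ N * (q ^ (k choose 2) * qbin q (2 * N) k * y ^ k)"
      unfolding yk power_minus[of x] by (simp add: mult_ac)
  qed auto
  finally show ?thesis by (simp add: q_def x_def)
qed

text \<open>The geometric series of \<open>c * q ^ j\<close> converges absolutely, hence so does the
  product, and an absolutely convergent product without zero factors has a nonzero limit.\<close>

lemma qprod_tendsto:
  fixes q c :: complex
  assumes "norm q < 1" "\<And>j. c * q ^ j \<noteq> 1"
  obtains L where "L \<noteq> 0" "(\<lambda>N. \<Prod>j<N. 1 - c * q ^ j) \<longlonglongrightarrow> L"
proof -
  have "summable (\<lambda>j. norm ((1 - c * q ^ j) - 1))"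
    using assms by (simp add: norm_mult norm_power summable_mult summable_geometric)
  then have conv: "convergent_prod (\<lambda>j. 1 - c * q ^ j)"
    by (intro abs_convergent_prod_imp_convergent_prod) (simp add: abs_convergent_prod_conv_summable)
  show thesis
  proof
    show "prodinf (\<lambda>j. 1 - c * q ^ j) \<noteq> 0"
      by (rule prodinf_nonzero[OF conv]) (use assms(2) in \<open>metis eq_iff_diff_eq_0\<close>)
    show "(\<lambda>N. \<Prod>j<N. 1 - c * q ^ j) \<longlonglongrightarrow> prodinf (\<lambda>j. 1 - c * q ^ j)"
      using convergent_prod_LIMSEQ[OF conv]
        LIMSEQ_lessThan_iff_atMost[of "prod (\<lambda>j. 1 - c * q ^ j)"] by blast
  qed
qed

text \<open>The constant \<open>C\<close> is \<open>1 / \<Prod>(1 - q ^ j)\<close>; only that it does not vanish matters.\<close>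
lemma theta_partial_tendsto:
  assumes "0 < Im \<eta>"
  obtains C where "C \<noteq> 0" "\<And>z. theta_partial (ee \<eta>) (ee z) \<longlonglongrightarrow> C * jtheta \<eta> z"
proof -
  define q where "q = ee \<eta>"
  have q1: "norm q < 1" using assms by (simp add: q_def norm_ee)
  from qprod_tendsto[OF q1 power_neq_1_of_norm_less[OF q1]]
  obtain Q where Q: "Q \<noteq> 0" "qfac q \<longlonglongrightarrow> Q"
    unfolding qfac_def by blast
  obtain A where A: "\<And>M. norm (qfac q M) \<le> A"
    using convergent_imp_Bseq[of "qfac q"] Q by (auto simp: convergent_def Bseq_def)
  obtain B where B: "\<And>M. norm (inverse (qfac q M)) \<le> B"
    using convergent_imp_Bseq[of "\<lambda>M. inverse (qfac q M)"] tendsto_inverse[OF Q(2,1)]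
    by (auto simp: convergent_def Bseq_def)
  have AB: "0 \<le> A" "0 \<le> B" using A B norm_ge_zero order_trans by blast+
  \<comment> \<open>Since \<open>qfac q\<close> has a nonzero limit, it and its inverse are bounded,
    which bounds all Gaussian binomials at once.\<close>
  have bound: "norm (qbin q M k) \<le> A * (B * B)" for M k
  proof -
    have "norm (qfac q M * (inverse (qfac q k) * inverse (qfac q (M - k)))) \<le> A * (B * B)"
      unfolding norm_mult by (intro mult_mono A B) (use AB in auto)
    then show ?thesis using AB by (auto simp: qbin_def divide_inverse)
  qed
  have "theta_partial q (ee z) \<longlonglongrightarrow> inverse Q * jtheta \<eta> z" for z
  proof -
    \<comment> \<open>Extension by zero puts all finite sums on the common index set of integers.
      The terms are dominated by a multiple of \<open>norm (jterm \<eta> z m)\<close>, uniformly in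
      \<open>N\<close>, so the limit may be taken termwise.\<close>
    define a where "a = (\<lambda>m N. if m \<in> {- int N..int N} then qbin q (2 * N) (nat (m + int N)) * jterm \<eta> z m else 0)"
    have "((\<lambda>m. a m N) has_sum theta_partial q (ee z) N) UNIV" for N
    proof -
      have "((\<lambda>m. qbin q (2 * N) (nat (m + int N)) * jterm \<eta> z m) has_sum theta_partial q (ee z) N) {- int N..int N}"
        using finite_jacobi_triple[OF assms] by (auto simp: q_def intro: has_sum_finiteI)
      also have "?this \<longleftrightarrow> ?thesis"
        by (rule has_sum_cong_neutral) (auto simp: a_def)
      finally show ?thesis .
    qed
    moreover have "norm (a m N) \<le> A * (B * B) * norm (jterm \<eta> z m)" for m N
      using bound AB by (auto simp: a_def norm_mult intro!: mult_right_mono)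
    ultimately have unif: "uniform_limit UNIV (\<lambda>X N. \<Sum>m\<in>X. a m N) (theta_partial q (ee z)) (finite_subsets_at_top UNIV)"
      by (intro Weierstrass_m_test_general'[where M = "\<lambda>m. A * (B * B) * norm (jterm \<eta> z m)"]
          summable_on_cmult_right abs_summable_jterm assms)
    \<comment> \<open>For fixed \<open>m\<close> the three indices 2 N, N + m and N - m all tend to
      infinity, so the Gaussian binomial tends to Q / (Q * Q).\<close>
    have lim: "a m \<longlonglongrightarrow> inverse Q * jterm \<eta> z m" for m
    proof -
      have sub: "filterlim f sequentially sequentially" if "\<And>Z N. Z + nat \<bar>m\<bar> \<le> N \<Longrightarrow> Z \<le> f N" for f
        unfolding filterlim_at_top
        by (intro allI, rule eventually_mono[OF eventually_ge_at_top], rule that)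
      have "filterlim (\<lambda>N. nat (m + int N)) sequentially sequentially"
        "filterlim (\<lambda>N. 2 * N - nat (m + int N)) sequentially sequentially"
        "filterlim (\<lambda>N. 2 * N) sequentially sequentially"
        by (rule sub, linarith)+
      note sub = this
      have "(\<lambda>N. qfac q (2 * N) / (qfac q (nat (m + int N)) * qfac q (2 * N - nat (m + int N))) * jterm \<eta> z m)
          \<longlonglongrightarrow> Q / (Q * Q) * jterm \<eta> z m"
        by (intro tendsto_intros sub[THEN filterlim_compose[OF Q(2)]]) (use Q in auto)
      moreover have "\<forall>\<^sub>F N in sequentially. qfac q (2 * N) / (qfac q (nat (m + int N)) * qfac q (2 * N - nat (m + int N))) * jterm \<eta> z m = a m N"
        using eventually_ge_at_top[of "nat \<bar>m\<bar>"]
        by eventually_elim (auto simp: a_def qbin_def)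
      ultimately have "a m \<longlonglongrightarrow> Q / (Q * Q) * jterm \<eta> z m"
        by (rule Lim_transform_eventually)
      then show ?thesis using Q by (simp add: field_simps)
    qed
    show ?thesis
    proof (rule swap_uniform_limit'[OF _ _ unif])
      show "\<forall>\<^sub>F X in finite_subsets_at_top UNIV. (\<lambda>N. \<Sum>m\<in>X. a m N) \<longlonglongrightarrow> (\<Sum>m\<in>X. inverse Q * jterm \<eta> z m)"
        by (intro always_eventually allI tendsto_intros lim)
      show "((\<lambda>X. \<Sum>m\<in>X. inverse Q * jterm \<eta> z m) \<longlongrightarrow> inverse Q * jtheta \<eta> z) (finite_subsets_at_top UNIV)"
        using has_sum_cmult_right[OF has_sum_jtheta[OF assms]] unfolding has_sum_def .
    qed auto
  qed
  then show thesis using that[of "inverse Q"] Q by (simp add: q_def)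
qed

text \<open>Away from the lattice no factor of the product expansion vanishes, so both infinite
  products have nonzero limits, and their product is a multiple of the theta value.\<close>

lemma jtheta_eq_0D:
  assumes "0 < Im \<eta>" "jtheta \<eta> z = 0"
  shows "\<exists>a b :: int. z = of_int a + of_int b * \<eta>"
proof (rule ccontr)
  assume no: "\<not> ?thesis"
  have q1: "norm (ee \<eta>) < 1" using assms by (simp add: norm_ee)
  have 1: "ee z * ee \<eta> ^ j \<noteq> 1" for j
  proof
    assume "ee z * ee \<eta> ^ j = 1"
    then have "ee (z + of_nat j * \<eta>) = 1" by (simp add: ee_add ee_of_nat_mult)
    then obtain a :: int where "z + of_nat j * \<eta> = of_int a" by (auto simp: ee_eq_1_iff elim: Ints_cases)
    then have "z = of_int a + of_int (- int j) * \<eta>" by (simp add: algebra_simps)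
    with no show False by blast
  qed
  have 2: "ee \<eta> / ee z * ee \<eta> ^ j \<noteq> 1" for j
  proof
    assume "ee \<eta> / ee z * ee \<eta> ^ j = 1"
    then have "ee (\<eta> + of_nat j * \<eta> - z) = 1" by (simp add: ee_add ee_diff ee_of_nat_mult)
    then obtain a :: int where "\<eta> + of_nat j * \<eta> - z = of_int a" by (auto simp: ee_eq_1_iff elim: Ints_cases)
    then have "z = of_int (- a) + of_int (int j + 1) * \<eta>" by (simp add: algebra_simps)
    with no show False by blast
  qed
  from qprod_tendsto[OF q1 1] obtain L1 where L1: "L1 \<noteq> 0" "(\<lambda>N. \<Prod>j<N. 1 - ee z * ee \<eta> ^ j) \<longlonglongrightarrow> L1" .
  from qprod_tendsto[OF q1 2] obtain L2 where L2: "L2 \<noteq> 0" "(\<lambda>N. \<Prod>j<N. 1 - ee \<eta> / ee z * ee \<eta> ^ j) \<longlonglongrightarrow> L2" .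
  have "theta_partial (ee \<eta>) (ee z) \<longlonglongrightarrow> L1 * L2"
    unfolding theta_partial_def by (intro tendsto_mult L1 L2)
  moreover obtain C where "theta_partial (ee \<eta>) (ee z) \<longlonglongrightarrow> C * jtheta \<eta> z"
    using theta_partial_tendsto[OF assms(1)] by blast
  ultimately have "L1 * L2 = C * jtheta \<eta> z" by (rule LIMSEQ_unique)
  then show False using L1 L2 assms by simp
qed

section \<open>Roots of unity and the passage from modulus \<eta> to n \<eta>\<close>

lemma prod_one_minus_roots_unity:
  fixes c :: complex
  assumes "n > 0"
  shows "(\<Prod>w | w ^ n = 1. 1 - c * w) = 1 - c ^ n"
proof -
  define S where "S = {w :: complex. w ^ n = 1}"
  have S: "finite S" "card S = n"
    using assms card_complex_roots_unity[of n] finite_roots_unity[of n] by (auto simp: S_def)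
  have "(\<Prod>w\<in>S. [:1, - w:]) = 1 - monom 1 n"
  \<comment> \<open>Both polynomials have degree at most n and agree at n + 1 points: at 0, and at
    each n-th root of unity x, where the factor with w = 1 / x vanishes.\<close>
  proof (rule poly_eqI_degree[of "insert 0 S"])
    show "poly (\<Prod>w\<in>S. [:1, - w:]) x = poly (1 - monom 1 n) x" if "x \<in> insert 0 S" for x
    proof (cases "x = 0")
      case False
      then have x: "x ^ n = 1" using that by (simp add: S_def)
      then have "inverse x \<in> S" by (simp add: S_def power_inverse)
      then have "(\<Prod>w\<in>S. 1 - x * w) = 0"
        using S False by (auto intro!: bexI[of _ "inverse x"])
      then show ?thesis using x by (simp add: poly_prod poly_monom)
    qed (use assms in \<open>simp add: poly_prod poly_monom\<close>)
    have "0 \<notin> S" using assms by (simp add: S_def power_0_left)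
    then have card: "card (insert 0 S) = Suc n" using S by simp
    have "degree (\<Prod>w\<in>S. [:1, - w:]) \<le> (\<Sum>w\<in>S. degree [:1, - w:])"
      using degree_prod_sum_le[OF S(1), of "\<lambda>w. [:1, - w:]"] unfolding o_def .
    also have "\<dots> \<le> (\<Sum>w\<in>S. 1)" by (intro sum_mono) simp
    finally show "degree (\<Prod>w\<in>S. [:1, - w:]) < card (insert 0 S)" using card S by simp
    have "degree (1 - monom (1::complex) n) \<le> n"
      by (intro degree_diff_le) (auto simp: degree_monom_le)
    then show "degree (1 - monom (1::complex) n) < card (insert 0 S)" using card by simp
  qed
  then have "poly (\<Prod>w\<in>S. [:1, - w:]) c = poly (1 - monom 1 n) c" by simp
  then show ?thesis by (simp add: poly_prod poly_monom S_def)
qed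

lemma prod_one_minus_ee:
  assumes "n > 0"
  shows "(\<Prod>m<n. 1 - c * ee (of_nat m / of_nat n)) = 1 - c ^ n"
    and "(\<Prod>m<n. 1 - c * ee (- (of_nat m / of_nat n))) = 1 - c ^ n"
proof -
  have bij: "bij_betw (\<lambda>m. cis (2 * pi * real m / real n)) {..<n} {w. w ^ n = 1}"
    using Complex.bij_betw_roots_unity[OF assms] .
  have cis: "cis (2 * pi * real m / real n) = ee (of_nat m / of_nat n)" for m
    by (simp add: cis_conv_exp ee_def mult_ac)
  show 1: "(\<Prod>m<n. 1 - c * ee (of_nat m / of_nat n)) = 1 - c ^ n" for c
    using prod.reindex_bij_betw[OF bij, of "\<lambda>w. 1 - c * w"] prod_one_minus_roots_unity[OF assms, of c]
    by (simp add: cis)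
  \<comment> \<open>Complex conjugation inverts the roots of unity, which reduces the second product
    to the first at \<open>cnj c\<close>.\<close>
  have "(\<Prod>m<n. 1 - c * ee (- (of_nat m / of_nat n))) = cnj (\<Prod>m<n. 1 - cnj c * ee (of_nat m / of_nat n))"
    by (simp add: ee_def exp_cnj)
  then show "(\<Prod>m<n. 1 - c * ee (- (of_nat m / of_nat n))) = 1 - c ^ n"
    unfolding 1 by simp
qed

text \<open>After exchanging the products, the translates by m / n multiply each factor's monomial
  by all n-th roots of unity, so the product over m replaces that monomial by its n-th
  power.\<close>

lemma theta_partial_isogeny:
  assumes "n > 0"
  shows "(\<Prod>m<n. theta_partial (ee \<eta>) (ee (z + of_nat m / of_nat n)) N)
    = theta_partial (ee (of_nat n * \<eta>)) (ee (of_nat n * z)) N"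
proof -
  have "(\<Prod>m<n. \<Prod>j<N. 1 - ee (z + of_nat m / of_nat n) * ee \<eta> ^ j)
      = (\<Prod>j<N. \<Prod>m<n. 1 - (ee z * ee \<eta> ^ j) * ee (of_nat m / of_nat n))"
    by (subst prod.swap) (simp add: ee_add mult_ac)
  also have "\<dots> = (\<Prod>j<N. 1 - ee (of_nat n * z) * ee (of_nat n * \<eta>) ^ j)"
    unfolding prod_one_minus_ee[OF assms] ee_of_nat_mult power_mult_distrib
    by (simp add: mult.commute[of n] flip: power_mult)
  finally have 1: "(\<Prod>m<n. \<Prod>j<N. 1 - ee (z + of_nat m / of_nat n) * ee \<eta> ^ j)
      = (\<Prod>j<N. 1 - ee (of_nat n * z) * ee (of_nat n * \<eta>) ^ j)" .
  have "(\<Prod>m<n. \<Prod>j<N. 1 - ee \<eta> / ee (z + of_nat m / of_nat n) * ee \<eta> ^ j)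
      = (\<Prod>j<N. \<Prod>m<n. 1 - (ee \<eta> / ee z * ee \<eta> ^ j) * ee (- (of_nat m / of_nat n)))"
    by (subst prod.swap) (simp add: ee_add ee_minus divide_inverse mult_ac)
  also have "\<dots> = (\<Prod>j<N. 1 - ee (of_nat n * \<eta>) / ee (of_nat n * z) * ee (of_nat n * \<eta>) ^ j)"
    unfolding prod_one_minus_ee[OF assms] ee_of_nat_mult power_mult_distrib power_divide
    by (simp add: mult.commute[of n] flip: power_mult)
  finally have 2: "(\<Prod>m<n. \<Prod>j<N. 1 - ee \<eta> / ee (z + of_nat m / of_nat n) * ee \<eta> ^ j)
      = (\<Prod>j<N. 1 - ee (of_nat n * \<eta>) / ee (of_nat n * z) * ee (of_nat n * \<eta>) ^ j)" .
  show ?thesis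
    unfolding theta_partial_def prod.distrib 1 2 ..
qed

text \<open>The limit of the truncated identity; the constant is the quotient of the normalizing
  constants of the two product expansions and is independent of \<open>z\<close>.\<close>

lemma jtheta_isogeny:
  assumes "0 < Im \<eta>" "n > 0"
  obtains C where "C \<noteq> 0"
    "\<And>z. (\<Prod>m<n. jtheta \<eta> (z + of_nat m / of_nat n)) = C * jtheta (of_nat n * \<eta>) (of_nat n * z)"
proof -
  have "0 < Im (of_nat n * \<eta>)" using assms by simp
  from theta_partial_tendsto[OF this] obtain C1 where
    C1: "C1 \<noteq> 0" "\<And>z. theta_partial (ee (of_nat n * \<eta>)) (ee z) \<longlonglongrightarrow> C1 * jtheta (of_nat n * \<eta>) z" by blast
  from theta_partial_tendsto[OF assms(1)] obtain C2 where
    C2: "C2 \<noteq> 0" "\<And>z. theta_partial (ee \<eta>) (ee z) \<longlonglongrightarrow> C2 * jtheta \<eta> z" by blast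
  have "(\<Prod>m<n. jtheta \<eta> (z + of_nat m / of_nat n)) = C1 / C2 ^ n * jtheta (of_nat n * \<eta>) (of_nat n * z)" for z
  proof -
    have "(\<lambda>N. \<Prod>m<n. theta_partial (ee \<eta>) (ee (z + of_nat m / of_nat n)) N)
        \<longlonglongrightarrow> (\<Prod>m<n. C2 * jtheta \<eta> (z + of_nat m / of_nat n))"
      by (intro tendsto_prod C2)
    then have "theta_partial (ee (of_nat n * \<eta>)) (ee (of_nat n * z))
        \<longlonglongrightarrow> C2 ^ n * (\<Prod>m<n. jtheta \<eta> (z + of_nat m / of_nat n))"
      by (simp add: theta_partial_isogeny[OF assms(2)] prod.distrib)
    from LIMSEQ_unique[OF this C1(2)] show ?thesis using C2(1) by (simp add: field_simps)
  qed
  then show thesis using that[of "C1 / C2 ^ n"] C1 C2 by simp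
qed

subsection \<open>The three-term relation\<close>

text \<open>The factor makes the function odd and removes all exponential factors from the identities below.\<close>
definition odd_theta :: "complex \<Rightarrow> complex \<Rightarrow> complex" where
  "odd_theta \<eta> z = ee (- z / 2) * jtheta \<eta> z"

lemma odd_theta_minus:
  assumes "0 < Im \<eta>"
  shows "odd_theta \<eta> (- z) = - odd_theta \<eta> z"
proof -
  have "- z / 2 = - (- z) / 2 + - z" by simp
  then have "ee (- z / 2) = ee (- (- z) / 2) * ee (- z)" by (metis ee_add)
  then show ?thesis by (simp only: odd_theta_def jtheta_minus[OF assms]) simp
qed

lemma jtheta_conv_odd_theta: "jtheta \<eta> z = ee (z / 2) * odd_theta \<eta> z"
  by (simp add: odd_theta_def ee_minus)

lemma odd_theta_eq_0_iff: "odd_theta \<eta> z = 0 \<longleftrightarrow> jtheta \<eta> z = 0"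
  by (simp add: odd_theta_def)

text \<open>By \<open>jtheta_product\<close> every s(x + y) s(x - y) is, up to one common constant,
  the determinant of two vectors attached to x and y. The relation is the Pluecker identity for four
  vectors in the plane.\<close>

lemma odd_theta_three_term:
  assumes "0 < Im \<eta>"
  defines "s \<equiv> odd_theta \<eta>"
  shows "s (a + b) * s (a - b) * (s (c + d) * s (c - d)) - s (a + c) * s (a - c) * (s (b + d) * s (b - d))
    + s (a + d) * s (a - d) * (s (b + c) * s (b - c)) = 0"
proof -
  have *: "s (x + y) * s (x - y)
      = ee (- \<eta> / 4) * (psi_sum \<eta> False x * psi_sum \<eta> True y - psi_sum \<eta> True x * psi_sum \<eta> False y)" for x y
  proof -
    have "- (x + y) / 2 + - (x - y) / 2 + (x - \<eta> / 4) = - \<eta> / 4" by (simp add: field_simps)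
    then have e: "ee (- \<eta> / 4) = ee (- (x + y) / 2) * ee (- (x - y) / 2) * ee (x - \<eta> / 4)"
      by (metis ee_add)
    have "s (x + y) * s (x - y) = ee (- (x + y) / 2) * ee (- (x - y) / 2) * (jtheta \<eta> (x + y) * jtheta \<eta> (x - y))"
      by (simp add: s_def odd_theta_def mult_ac)
    then show ?thesis unfolding jtheta_product[OF assms(1)] e by (simp only: mult.assoc)
  qed
  show ?thesis unfolding * by (simp add: algebra_simps)
qed

lemma odd_theta_fay:
  assumes "0 < Im \<eta>"
  defines "s \<equiv> odd_theta \<eta>"
  shows "s (x1 + y1) * s (x2 + y2) * s (x1 + x2) * s (y2 - y1)
    = s (x1 + x2 + y1) * s (x2 + (y2 - y1)) * s x1 * s y2 - s (x1 + x2 + y2) * s (x1 + (y1 - y2)) * s x2 * s y1"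
proof -
  \<comment> \<open>Chosen so that the twelve sums and differences in the three-term relation are
    the twelve arguments of the claim.\<close>
  define a where "a = x1 + (x2 + y1) / 2"
  define b where "b = y2 + (x2 - y1) / 2"
  define c where "c = (x2 + y1) / 2"
  define d where "d = (x2 - y1) / 2"
  have "a + b = x1 + x2 + y2" "a - b = x1 + (y1 - y2)" "c + d = x2" "c - d = y1"
    "a + c = x1 + x2 + y1" "a - c = x1" "b + d = x2 + (y2 - y1)" "b - d = y2"
    "a + d = x1 + x2" "a - d = x1 + y1" "b + c = x2 + y2" "b - c = y2 - y1"
    by (simp_all add: a_def b_def c_def d_def field_simps)
  with odd_theta_three_term[OF assms(1), of a b c d] show ?thesis
    by (simp add: s_def algebra_simps)
qed

text \<open>The classical Kronecker function without its normalizing factor, the derivative of theta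
  at 0.\<close>

definition kron :: "complex \<Rightarrow> complex \<Rightarrow> complex \<Rightarrow> complex" where
  "kron \<eta> x y = odd_theta \<eta> (x + y) / (odd_theta \<eta> x * odd_theta \<eta> y)"

text \<open>Division of \<open>odd_theta_fay\<close> by the six odd theta values that are assumed
  nonzero; oddness turns the minus sign there into the argument \<open>y1 - y2\<close>.\<close>

lemma kron_fay:
  assumes "0 < Im \<eta>"
    and "odd_theta \<eta> x1 \<noteq> 0" "odd_theta \<eta> x2 \<noteq> 0" "odd_theta \<eta> (x1 + x2) \<noteq> 0"
    and "odd_theta \<eta> y1 \<noteq> 0" "odd_theta \<eta> y2 \<noteq> 0" "odd_theta \<eta> (y2 - y1) \<noteq> 0"
  shows "kron \<eta> x1 y1 * kron \<eta> x2 y2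
    = kron \<eta> (x1 + x2) y1 * kron \<eta> x2 (y2 - y1) + kron \<eta> (x1 + x2) y2 * kron \<eta> x1 (y1 - y2)"
proof -
  have m: "odd_theta \<eta> (y1 - y2) = - odd_theta \<eta> (y2 - y1)"
    using odd_theta_minus[OF assms(1), of "y2 - y1"] by simp
  have "kron \<eta> (x1 + x2) y1 * kron \<eta> x2 (y2 - y1) + kron \<eta> (x1 + x2) y2 * kron \<eta> x1 (y1 - y2)
      = (odd_theta \<eta> (x1 + x2 + y1) * odd_theta \<eta> (x2 + (y2 - y1)) * odd_theta \<eta> x1 * odd_theta \<eta> y2
          - odd_theta \<eta> (x1 + x2 + y2) * odd_theta \<eta> (x1 + (y1 - y2)) * odd_theta \<eta> x2 * odd_theta \<eta> y1)
        / (odd_theta \<eta> x1 * odd_theta \<eta> x2 * odd_theta \<eta> y1 * odd_theta \<eta> y2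
          * odd_theta \<eta> (x1 + x2) * odd_theta \<eta> (y2 - y1))"
    unfolding kron_def m diff_divide_distrib using assms by (simp add: mult_ac)
  also have "\<dots> = kron \<eta> x1 y1 * kron \<eta> x2 y2"
    unfolding odd_theta_fay[OF assms(1), symmetric] kron_def using assms by simp
  finally show ?thesis ..
qed

text \<open>Replaces Fay's identity in the degenerate case \<open>y\<^sub>1 = y\<^sub>2\<close>. The point is that \<open>N\<close> does not depend
  on \<open>y\<close>.\<close>
lemma kron_product_difference:
  assumes "0 < Im \<eta>" "x1 + x2 = x" "x1' + x2' = x"
    and "odd_theta \<eta> x1 \<noteq> 0" "odd_theta \<eta> x2 \<noteq> 0" "odd_theta \<eta> x1' \<noteq> 0" "odd_theta \<eta> x2' \<noteq> 0"
    and "odd_theta \<eta> x \<noteq> 0"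
  obtains N where "\<And>y. odd_theta \<eta> y \<noteq> 0 \<Longrightarrow>
    kron \<eta> x1 y * kron \<eta> x2 y = kron \<eta> x1' y * kron \<eta> x2' y + N * kron \<eta> x y"
proof
  fix y assume y: "odd_theta \<eta> y \<noteq> 0"
  let ?s = "odd_theta \<eta>"
  \<comment> \<open>Centring at x / 2 makes \<open>y\<close> enter through \<open>p\<close> alone.
    The coefficient of s(p + h) s(p - h) = s(x + y) s(y) is then free of \<open>y\<close>, and it
    becomes \<open>N\<close>.\<close>
  define p where "p = x / 2 + y"
  define a where "a = x1 - x / 2"
  define h where "h = x / 2"
  define b where "b = x1' - x / 2"
  have x2: "x2 = x - x1" "x2' = x - x1'" using assms(2,3) by (simp_all add: eq_diff_eq add.commute)
  have eqs: "p + a = x1 + y" "p - a = x2 + y" "h + b = x1'" "h - b = x2'"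
    "p + h = x + y" "p - h = y" "p + b = x1' + y" "p - b = x2' + y" "a + h = x1" "a - h = - x2"
    "a + b = x1 + x1' - x" "a - b = x1 - x1'"
    unfolding x2 by (simp_all add: a_def b_def p_def h_def field_simps)
  have "?s (x1 + y) * ?s (x2 + y) * (?s x1' * ?s x2')
      = ?s (x1' + y) * ?s (x2' + y) * (?s x1 * ?s x2) + ?s (x + y) * ?s y * (?s (x1 + x1' - x) * ?s (x1 - x1'))"
    using odd_theta_three_term[OF assms(1), of p a h b]
    unfolding eqs odd_theta_minus[OF assms(1), of x2] by (simp add: algebra_simps)
  then have "?s (x1 + y) * ?s (x2 + y) / (?s x1 * ?s x2)
      = ?s (x1' + y) * ?s (x2' + y) / (?s x1' * ?s x2')
        + ?s (x + y) * ?s y * (?s (x1 + x1' - x) * ?s (x1 - x1')) / (?s x1 * ?s x2 * ?s x1' * ?s x2')"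
    using assms by (simp add: field_simps)
  then have "?s (x1 + y) * ?s (x2 + y) / (?s x1 * ?s x2) / (?s y * ?s y)
      = (?s (x1' + y) * ?s (x2' + y) / (?s x1' * ?s x2')
        + ?s (x + y) * ?s y * (?s (x1 + x1' - x) * ?s (x1 - x1')) / (?s x1 * ?s x2 * ?s x1' * ?s x2')) / (?s y * ?s y)"
    by simp
  then show "kron \<eta> x1 y * kron \<eta> x2 y = kron \<eta> x1' y * kron \<eta> x2' y
      + (?s (x1 + x1' - x) * ?s (x1 - x1') * ?s x / (?s x1 * ?s x2 * ?s x1' * ?s x2')) * kron \<eta> x y"
    unfolding kron_def add_divide_distrib using assms y by (simp add: mult_ac)
qed

section \<open>The functions theta_alpha as single theta functions of modulus n \<eta>\<close>

lemma theta_idx_conv_jtheta: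
  assumes "0 < Im \<eta>" "n > 0"
  obtains C where "C \<noteq> 0" "\<And>\<alpha> z. theta_idx n \<eta> \<alpha> z =
     C * (ee (of_int \<alpha> * z + of_int \<alpha> / (2 * of_nat n) + of_int \<alpha> * (of_int \<alpha> - of_nat n) / (2 * of_nat n) * \<eta>)
     * jtheta (of_nat n * \<eta>) (of_nat n * z + of_int \<alpha> * \<eta>))"
proof -
  obtain C where C: "C \<noteq> 0"
    "\<And>z. (\<Prod>m<n. jtheta \<eta> (z + of_nat m / of_nat n)) = C * jtheta (of_nat n * \<eta>) (of_nat n * z)"
    using jtheta_isogeny[OF assms] by blast
  \<comment> \<open>The factors are the translates by m / n of the point z + \<alpha> \<eta> / n, so
    the one constant of the isogeny serves all indices.\<close>
  have "theta_idx n \<eta> \<alpha> z =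
     C * (ee (of_int \<alpha> * z + of_int \<alpha> / (2 * of_nat n) + of_int \<alpha> * (of_int \<alpha> - of_nat n) / (2 * of_nat n) * \<eta>)
     * jtheta (of_nat n * \<eta>) (of_nat n * z + of_int \<alpha> * \<eta>))" for \<alpha> z
    using C(2)[of "z + of_int \<alpha> / of_nat n * \<eta>"] assms
    by (simp add: theta_idx_def algebra_simps)
  with C(1) that show thesis by blast
qed

text \<open>The lattice zeros of modulus n \<eta>, pulled back. The congruence for \<open>q\<close>
  records which index vanishes at which point; it is what decides the case z = 0.\<close>

lemma theta_idx_eq_0D:
  assumes "0 < Im \<eta>" "n > 0" "theta_idx n \<eta> \<alpha> z = 0"
  shows "\<exists>p q :: int. z = (of_int p + of_int q * \<eta>) / of_nat n \<and> int n dvd (q + \<alpha>)"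
proof -
  obtain C where C: "C \<noteq> 0" "\<And>\<alpha> z. theta_idx n \<eta> \<alpha> z =
     C * (ee (of_int \<alpha> * z + of_int \<alpha> / (2 * of_nat n) + of_int \<alpha> * (of_int \<alpha> - of_nat n) / (2 * of_nat n) * \<eta>)
     * jtheta (of_nat n * \<eta>) (of_nat n * z + of_int \<alpha> * \<eta>))"
    using theta_idx_conv_jtheta[OF assms(1,2)] by blast
  then have 0: "jtheta (of_nat n * \<eta>) (of_nat n * z + of_int \<alpha> * \<eta>) = 0" using assms(3) by simp
  have "0 < Im (of_nat n * \<eta>)" using assms by simp
  from jtheta_eq_0D[OF this 0] obtain p b :: int where "of_nat n * z + of_int \<alpha> * \<eta> = of_int p + of_int b * (of_nat n * \<eta>)"
    by blast
  then have "z = (of_int p + of_int (b * int n - \<alpha>) * \<eta>) / of_nat n"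
    using assms(2) by (simp add: field_simps)
  then show ?thesis
    by (intro exI[of _ p] exI[of _ "b * int n - \<alpha>"]) simp
qed

text \<open>Raising the index by n translates the theta argument x by its quasi-period. The
  resulting factor - e(-x) is compensated by the prefactor, whose exponent grows by x + 1/2.\<close>

lemma theta_idx_plus_period:
  assumes "0 < Im \<eta>" "n > 0"
  shows "theta_idx n \<eta> (\<alpha> + int n) z = theta_idx n \<eta> \<alpha> z"
proof -
  obtain C where C: "C \<noteq> 0" "\<And>\<alpha> z. theta_idx n \<eta> \<alpha> z =
     C * (ee (of_int \<alpha> * z + of_int \<alpha> / (2 * of_nat n) + of_int \<alpha> * (of_int \<alpha> - of_nat n) / (2 * of_nat n) * \<eta>)
     * jtheta (of_nat n * \<eta>) (of_nat n * z + of_int \<alpha> * \<eta>))"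
    using theta_idx_conv_jtheta[OF assms] by blast
  let ?x = "of_nat n * z + of_int \<alpha> * \<eta>"
  have j: "jtheta (of_nat n * \<eta>) (of_nat n * z + of_int (\<alpha> + int n) * \<eta>) = - ee (- ?x) * jtheta (of_nat n * \<eta>) ?x"
    using jtheta_plus_period[of "of_nat n * \<eta>" ?x] assms by (simp add: algebra_simps)
  have "of_int (\<alpha> + int n) * z + of_int (\<alpha> + int n) / (2 * of_nat n)
        + of_int (\<alpha> + int n) * (of_int (\<alpha> + int n) - of_nat n) / (2 * of_nat n) * \<eta> + - ?x
      = (of_int \<alpha> * z + of_int \<alpha> / (2 * of_nat n) + of_int \<alpha> * (of_int \<alpha> - of_nat n) / (2 * of_nat n) * \<eta>) + 1 / 2"
    using assms(2) by (simp add: field_simps)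
  then have "ee (of_int (\<alpha> + int n) * z + of_int (\<alpha> + int n) / (2 * of_nat n)
        + of_int (\<alpha> + int n) * (of_int (\<alpha> + int n) - of_nat n) / (2 * of_nat n) * \<eta>) * ee (- ?x)
      = - ee (of_int \<alpha> * z + of_int \<alpha> / (2 * of_nat n) + of_int \<alpha> * (of_int \<alpha> - of_nat n) / (2 * of_nat n) * \<eta>)"
    by (simp only: ee_add[symmetric]) (simp only: ee_add ee_half mult_minus1_right)
  then show ?thesis
    unfolding C(2) j by (simp add: mult.assoc[symmetric])
qed

lemma theta_idx_cong:
  assumes "0 < Im \<eta>" "n > 0" "\<alpha> mod int n = \<beta> mod int n"
  shows "theta_idx n \<eta> \<alpha> z = theta_idx n \<eta> \<beta> z"
proof -
  have *: "theta_idx n \<eta> (\<alpha> + int m * int n) z = theta_idx n \<eta> \<alpha> z" for \<alpha> m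
  proof (induction m)
    case (Suc m)
    then show ?case
      using theta_idx_plus_period[OF assms(1,2), of "\<alpha> + int m * int n" z] by (simp add: algebra_simps)
  qed simp
  obtain d where d: "\<alpha> = \<beta> + d * int n"
    using assms(3) by (metis mod_eqE mult.commute)
  show ?thesis
  proof (cases "d \<ge> 0")
    case True
    then show ?thesis using *[of \<beta> "nat d"] d by simp
  next
    case False
    then show ?thesis using *[of \<alpha> "nat (- d)"] d by simp
  qed
qed

subsection \<open>Kronecker functions with characteristics\<close>

text \<open>The Kronecker function on pairs (index, complex number). The coefficients of
  \<open>Rmat\<close> have this form with first pair (a - i, - z) and second pair (k (j - a),
  \<tau>).\<close>

definition theta_kron :: "nat \<Rightarrow> complex \<Rightarrow> int \<Rightarrow> complex \<Rightarrow> int \<Rightarrow> complex \<Rightarrow> complex" where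
  "theta_kron n \<eta> a z b w = theta_idx n \<eta> (a + b) (z + w) / (theta_idx n \<eta> a z * theta_idx n \<eta> b w)"

text \<open>The exponent \<open>E\<close> is a quadratic form plus a linear form in (\<alpha>, z).
  The linear part cancels in the quotient, and the quadratic part leaves its polarization, which is
  bilinear in the two pairs.\<close>

lemma theta_kron_conv_kron:
  assumes "0 < Im \<eta>" "n > 0"
  obtains C where "C \<noteq> 0" "\<And>a z b w. theta_kron n \<eta> a z b w =
     C * ee (of_int a * w + of_int b * z + of_int a * of_int b / of_nat n * \<eta>)
       * kron (of_nat n * \<eta>) (of_nat n * z + of_int a * \<eta>) (of_nat n * w + of_int b * \<eta>)"
proof -
  define E where "E = (\<lambda>\<alpha> z. of_int \<alpha> * z + of_int \<alpha> / (2 * of_nat n)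
      + of_int \<alpha> * (of_int \<alpha> - of_nat n) / (2 * of_nat n) * \<eta> + (of_nat n * z + of_int \<alpha> * \<eta>) / 2)"
  obtain C where C: "C \<noteq> 0" "\<And>\<alpha> z. theta_idx n \<eta> \<alpha> z =
     C * (ee (of_int \<alpha> * z + of_int \<alpha> / (2 * of_nat n) + of_int \<alpha> * (of_int \<alpha> - of_nat n) / (2 * of_nat n) * \<eta>)
     * jtheta (of_nat n * \<eta>) (of_nat n * z + of_int \<alpha> * \<eta>))"
    using theta_idx_conv_jtheta[OF assms] by blast
  then have T: "theta_idx n \<eta> \<alpha> z = C * ee (E \<alpha> z) * odd_theta (of_nat n * \<eta>) (of_nat n * z + of_int \<alpha> * \<eta>)" for \<alpha> z
    by (simp only: jtheta_conv_odd_theta E_def ee_add mult.assoc)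
  have "theta_kron n \<eta> a z b w =
     inverse C * ee (of_int a * w + of_int b * z + of_int a * of_int b / of_nat n * \<eta>)
       * kron (of_nat n * \<eta>) (of_nat n * z + of_int a * \<eta>) (of_nat n * w + of_int b * \<eta>)" for a z b w
  proof -
    have "E (a + b) (z + w) = (of_int a * w + of_int b * z + of_int a * of_int b / of_nat n * \<eta>) + E a z + E b w"
      using assms(2) by (simp add: E_def field_simps)
    then have e: "ee (E (a + b) (z + w))
        = ee (of_int a * w + of_int b * z + of_int a * of_int b / of_nat n * \<eta>) * ee (E a z) * ee (E b w)"
      by (simp only: ee_add)
    have x: "of_nat n * (z + w) + of_int (a + b) * \<eta> = of_nat n * z + of_int a * \<eta> + (of_nat n * w + of_int b * \<eta>)"
      by (simp add: algebra_simps)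
    show ?thesis
      unfolding theta_kron_def T e x kron_def using C(1) by (simp add: field_simps)
  qed
  then show thesis using that[of "inverse C"] C(1) by simp
qed

lemma theta_idx_eq_0_iff:
  assumes "0 < Im \<eta>" "n > 0"
  shows "theta_idx n \<eta> \<alpha> z = 0 \<longleftrightarrow> odd_theta (of_nat n * \<eta>) (of_nat n * z + of_int \<alpha> * \<eta>) = 0"
proof -
  obtain C where C: "C \<noteq> 0" "\<And>\<alpha> z. theta_idx n \<eta> \<alpha> z =
     C * (ee (of_int \<alpha> * z + of_int \<alpha> / (2 * of_nat n) + of_int \<alpha> * (of_int \<alpha> - of_nat n) / (2 * of_nat n) * \<eta>)
     * jtheta (of_nat n * \<eta>) (of_nat n * z + of_int \<alpha> * \<eta>))"
    using theta_idx_conv_jtheta[OF assms] by blast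
  then show ?thesis by (simp add: odd_theta_eq_0_iff)
qed

text \<open>Since the exponent of the prefactor is bilinear, the prefactors of all three products
  coincide, and the identity reduces to \<open>kron_fay\<close>.\<close>

lemma theta_kron_fay:
  assumes "0 < Im \<eta>" "n > 0"
    and "theta_idx n \<eta> a1 z1 \<noteq> 0" "theta_idx n \<eta> a2 z2 \<noteq> 0" "theta_idx n \<eta> (a1 + a2) (z1 + z2) \<noteq> 0"
    and "theta_idx n \<eta> b1 w1 \<noteq> 0" "theta_idx n \<eta> b2 w2 \<noteq> 0" "theta_idx n \<eta> (b2 - b1) (w2 - w1) \<noteq> 0"
  shows "theta_kron n \<eta> a1 z1 b1 w1 * theta_kron n \<eta> a2 z2 b2 w2
    = theta_kron n \<eta> (a1 + a2) (z1 + z2) b1 w1 * theta_kron n \<eta> a2 z2 (b2 - b1) (w2 - w1)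
      + theta_kron n \<eta> (a1 + a2) (z1 + z2) b2 w2 * theta_kron n \<eta> a1 z1 (b1 - b2) (w1 - w2)"
proof -
  define e where "e = (\<lambda>a z b w. ee (of_int a * w + of_int b * z + of_int a * of_int b / of_nat n * \<eta>))"
  define l where "l = (\<lambda>a z. of_nat n * z + of_int a * \<eta>)"
  have l_eq: "of_nat n * z + of_int a * \<eta> = l a z" for a z by (simp add: l_def)
  obtain C where C: "C \<noteq> 0" "\<And>a z b w. theta_kron n \<eta> a z b w = C * e a z b w * kron (of_nat n * \<eta>) (l a z) (l b w)"
    using theta_kron_conv_kron[OF assms(1,2)] unfolding e_def l_def by blast
  have l: "l (a + a') (z + z') = l a z + l a' z'" "l (a - a') (z - z') = l a z - l a' z'" for a a' z z'
    by (simp_all add: l_def algebra_simps)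
  have fay: "kron (of_nat n * \<eta>) (l a1 z1) (l b1 w1) * kron (of_nat n * \<eta>) (l a2 z2) (l b2 w2)
    = kron (of_nat n * \<eta>) (l a1 z1 + l a2 z2) (l b1 w1) * kron (of_nat n * \<eta>) (l a2 z2) (l b2 w2 - l b1 w1)
      + kron (of_nat n * \<eta>) (l a1 z1 + l a2 z2) (l b2 w2) * kron (of_nat n * \<eta>) (l a1 z1) (l b1 w1 - l b2 w2)"
    using assms(3-8)[unfolded theta_idx_eq_0_iff[OF assms(1,2)] l_eq l]
    by (intro kron_fay) (use assms(1,2) in auto)
  have e1: "e (a1 + a2) (z1 + z2) b1 w1 * e a2 z2 (b2 - b1) (w2 - w1) = e a1 z1 b1 w1 * e a2 z2 b2 w2"
    unfolding e_def ee_add[symmetric] by (rule arg_cong[of _ _ ee]) (use assms(2) in \<open>simp add: field_simps\<close>)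
  have e2: "e (a1 + a2) (z1 + z2) b2 w2 * e a1 z1 (b1 - b2) (w1 - w2) = e a1 z1 b1 w1 * e a2 z2 b2 w2"
    unfolding e_def ee_add[symmetric] by (rule arg_cong[of _ _ ee]) (use assms(2) in \<open>simp add: field_simps\<close>)
  define K where "K = kron (of_nat n * \<eta>)"
  have "theta_kron n \<eta> (a1 + a2) (z1 + z2) b1 w1 * theta_kron n \<eta> a2 z2 (b2 - b1) (w2 - w1)
      + theta_kron n \<eta> (a1 + a2) (z1 + z2) b2 w2 * theta_kron n \<eta> a1 z1 (b1 - b2) (w1 - w2)
    = C * C * ((e (a1 + a2) (z1 + z2) b1 w1 * e a2 z2 (b2 - b1) (w2 - w1)) * (K (l a1 z1 + l a2 z2) (l b1 w1) * K (l a2 z2) (l b2 w2 - l b1 w1)))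
      + C * C * ((e (a1 + a2) (z1 + z2) b2 w2 * e a1 z1 (b1 - b2) (w1 - w2)) * (K (l a1 z1 + l a2 z2) (l b2 w2) * K (l a1 z1) (l b1 w1 - l b2 w2)))"
    unfolding C(2) l K_def by (simp only: mult_ac)
  also have "\<dots> = C * C * (e a1 z1 b1 w1 * e a2 z2 b2 w2) * (K (l a1 z1) (l b1 w1) * K (l a2 z2) (l b2 w2))"
    unfolding e1 e2 K_def fay by (simp only: distrib_left mult.assoc)
  finally show ?thesis unfolding C(2) K_def by (simp only: mult_ac)
qed

text \<open>By bilinearity both products carry the prefactor of
  \<open>theta_kron n \<eta> a z b w\<close> itself, so the scalar stays independent of
  \<open>(b, w)\<close>.\<close>

lemma theta_kron_product_difference:
  assumes "0 < Im \<eta>" "n > 0" "a1 + a2 = a" "a1' + a2' = a" "z1 + z2 = z"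
    and "theta_idx n \<eta> a1 z1 \<noteq> 0" "theta_idx n \<eta> a2 z2 \<noteq> 0"
    and "theta_idx n \<eta> a1' z1 \<noteq> 0" "theta_idx n \<eta> a2' z2 \<noteq> 0" "theta_idx n \<eta> a z \<noteq> 0"
  obtains N where "\<And>b w. theta_idx n \<eta> b w \<noteq> 0 \<Longrightarrow>
    theta_kron n \<eta> a1 z1 b w * theta_kron n \<eta> a2 z2 b w
    = theta_kron n \<eta> a1' z1 b w * theta_kron n \<eta> a2' z2 b w + N * theta_kron n \<eta> a z b w"
proof -
  define e where "e = (\<lambda>a z b w. ee (of_int a * w + of_int b * z + of_int a * of_int b / of_nat n * \<eta>))"
  define l where "l = (\<lambda>a z. of_nat n * z + of_int a * \<eta>)"
  have l_eq: "of_nat n * z + of_int a * \<eta> = l a z" for a z by (simp add: l_def)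
  define K where "K = kron (of_nat n * \<eta>)"
  obtain C where C: "C \<noteq> 0" "\<And>a z b w. theta_kron n \<eta> a z b w = C * e a z b w * K (l a z) (l b w)"
    using theta_kron_conv_kron[OF assms(1,2)] unfolding e_def l_def K_def by blast
  have l: "l (a + a') (z + z') = l a z + l a' z'" for a a' z z'
    by (simp add: l_def algebra_simps)
  have a: "l a1 z1 + l a2 z2 = l a z" "l a1' z1 + l a2' z2 = l a z"
    using assms by (simp_all flip: l)
  have im: "0 < Im (of_nat n * \<eta>)" using assms by simp
  note nz = assms(6-10)[unfolded theta_idx_eq_0_iff[OF assms(1,2)] l_eq]
  obtain N where N: "\<And>y. odd_theta (of_nat n * \<eta>) y \<noteq> 0 \<Longrightarrow>
    K (l a1 z1) y * K (l a2 z2) y = K (l a1' z1) y * K (l a2' z2) y + N * K (l a z) y"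
    using kron_product_difference[OF im a nz] unfolding K_def by blast
  have "e c z1 b w * e d z2 b w = e (c + d) (z1 + z2) b w" for b w c d
    unfolding e_def ee_add[symmetric] by (rule arg_cong[of _ _ ee]) (simp add: algebra_simps add_divide_distrib)
  then have e: "e a1 z1 b w * e a2 z2 b w = e a z b w" "e a1' z1 b w * e a2' z2 b w = e a z b w" for b w
    by (simp_all add: assms(3-5))
  show thesis
  proof (rule that)
    fix b w assume "theta_idx n \<eta> b w \<noteq> 0"
    then have "odd_theta (of_nat n * \<eta>) (l b w) \<noteq> 0" by (simp add: theta_idx_eq_0_iff[OF assms(1,2)] l_def)
    note N = N[OF this]
    have "theta_kron n \<eta> a1 z1 b w * theta_kron n \<eta> a2 z2 b w = C * C * (e a1 z1 b w * e a2 z2 b w) * (K (l a1 z1) (l b w) * K (l a2 z2) (l b w))"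
      unfolding C(2) by (simp only: mult_ac)
    also have "\<dots> = C * C * (e a1' z1 b w * e a2' z2 b w) * (K (l a1' z1) (l b w) * K (l a2' z2) (l b w)) + (C * N) * (C * e a z b w * K (l a z) (l b w))"
      unfolding e N by (simp add: algebra_simps)
    also have "C * C * (e a1' z1 b w * e a2' z2 b w) * (K (l a1' z1) (l b w) * K (l a2' z2) (l b w)) = theta_kron n \<eta> a1' z1 b w * theta_kron n \<eta> a2' z2 b w"
      unfolding C(2) by (simp only: mult_ac)
    finally show "theta_kron n \<eta> a1 z1 b w * theta_kron n \<eta> a2 z2 b w
      = theta_kron n \<eta> a1' z1 b w * theta_kron n \<eta> a2' z2 b w + (C * N) * theta_kron n \<eta> a z b w"
      unfolding C(2) .
  qed
qed

subsection \<open>Reflected sums over the cyclic group\<close>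

lemma sum_idx_reflect:
  fixes P :: "int \<Rightarrow> complex"
  assumes "n > 0" and P: "\<And>p. P (p mod int n) = P p"
  shows "(\<Sum>p\<in>idx n. P (c - p)) = (\<Sum>p\<in>idx n. P p)"
proof -
  have inv: "(c - (c - p) mod int n) mod int n = p mod int n" for p
    by (simp add: mod_diff_right_eq)
  have "(\<Sum>p\<in>idx n. P (c - p)) = (\<Sum>p\<in>idx n. P ((c - p) mod int n))"
    by (simp only: P)
  also have "\<dots> = (\<Sum>p\<in>idx n. P p)"
    by (rule sum.reindex_bij_witness[of _ "\<lambda>p. (c - p) mod int n" "\<lambda>p. (c - p) mod int n"])
       (use assms(1) inv in \<open>auto simp: idx_def\<close>)
  finally show ?thesis .
qed

lemma periodic_cong:
  fixes g :: "int \<Rightarrow> int \<Rightarrow> 'a"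
  assumes "\<And>a b. g (a mod m) b = g a b" "\<And>a b. g a (b mod m) = g a b"
    and "a mod m = a' mod m" "b mod m = b' mod m"
  shows "g a b = g a' b'"
  by (metis assms)

text \<open>Here \<open>g1\<close>, \<open>g2\<close>, \<open>g3\<close> stand for the coefficients
  at u, u + v, v, and \<open>h1\<close>, \<open>h3\<close> for Kronecker functions whose second
  complex argument is 0. In the outer factors the sum of the first indices and the difference of the
  second ones are independent of \<open>p\<close>, so Fay's identity yields terms of one shape on
  both sides.\<close>

lemma star_triangle_sum_generic:
  fixes g1 g2 g3 h1 h3 :: "int \<Rightarrow> int \<Rightarrow> complex"
  assumes n: "n > 0"
    and per: "\<And>a b. g1 (a mod int n) b = g1 a b" "\<And>a b. g1 a (b mod int n) = g1 a b"
      "\<And>a b. g2 (a mod int n) b = g2 a b" "\<And>a b. g2 a (b mod int n) = g2 a b"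
      "\<And>a b. g3 (a mod int n) b = g3 a b" "\<And>a b. g3 a (b mod int n) = g3 a b"
      "\<And>a b. h1 (a mod int n) b = h1 a b" "\<And>a b. h1 a (b mod int n) = h1 a b"
      "\<And>a b. h3 (a mod int n) b = h3 a b" "\<And>a b. h3 a (b mod int n) = h3 a b"
    and fay: "\<And>a a' b b'. b mod int n \<noteq> b' mod int n \<Longrightarrow>
      g3 a b * g1 a' b' = g2 (a + a') b * h1 a' (b' - b) + g2 (a + a') b' * h3 a (b - b')"
    and jt: "j mod int n \<noteq> t mod int n"
  shows "(\<Sum>p\<in>idx n. g1 (s - p) (t - p) * g2 (s + t - i - j) (l - s - t + p) * g3 (p - i) (j - p))
    = (\<Sum>p\<in>idx n. g3 (s + t - i - p) (j + l - p - t) * g2 (s - i) (p - s) * g1 (p - j) (l - p))"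
proof -
  let ?X = "s + t - i - j"
  define A where "A = (\<lambda>p. g2 (s - i) (j - p) * h1 (s - p) (t - j) * g2 ?X (l - s - t + p))"
  define B where "B = (\<lambda>p. g2 (s - i) (t - p) * h3 (p - i) (j - t) * g2 ?X (l - s - t + p))"
  have "g1 (s - p) (t - p) * g2 ?X (l - s - t + p) * g3 (p - i) (j - p) = A p + B p" for p
  proof -
    have "(j - p) mod int n \<noteq> (t - p) mod int n"
    proof
      assume "(j - p) mod int n = (t - p) mod int n"
      then have "(j - p + p) mod int n = (t - p + p) mod int n" by (intro mod_add_cong) auto
      with jt show False by simp
    qed
    note fay = fay[OF this, of "p - i" "s - p"]
    have e: "p - i + (s - p) = s - i" "t - p - (j - p) = t - j" "j - p - (t - p) = j - t" by simp_all
    have "g1 (s - p) (t - p) * g2 ?X (l - s - t + p) * g3 (p - i) (j - p)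
      = (g3 (p - i) (j - p) * g1 (s - p) (t - p)) * g2 ?X (l - s - t + p)"
      by (simp only: mult_ac)
    then show ?thesis
      unfolding fay e A_def B_def by (simp only: distrib_right)
  qed
  then have L: "(\<Sum>p\<in>idx n. g1 (s - p) (t - p) * g2 ?X (l - s - t + p) * g3 (p - i) (j - p))
      = (\<Sum>p\<in>idx n. A p) + (\<Sum>p\<in>idx n. B p)"
    by (simp add: sum.distrib)
  \<comment> \<open>The right summand splits into the same two functions, each reflected about its
    own centre; periodicity makes the sums blind to the reflections.\<close>
  have "g3 (s + t - i - p) (j + l - p - t) * g2 (s - i) (p - s) * g1 (p - j) (l - p) = A (s + j - p) + B (s + t - p)" for p
  proof -
    have "(j + l - p - t) mod int n \<noteq> (l - p) mod int n"
    proof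
      assume "(j + l - p - t) mod int n = (l - p) mod int n"
      then have "(j + l - p - t - (l - p - t)) mod int n = (l - p - (l - p - t)) mod int n"
        by (rule mod_diff_cong[OF _ refl])
      with jt show False by simp
    qed
    note fay = fay[OF this, of "s + t - i - p" "p - j"]
    have e: "s + t - i - p + (p - j) = ?X" "l - p - (j + l - p - t) = t - j" "j + l - p - t - (l - p) = j - t" by simp_all
    have "g3 (s + t - i - p) (j + l - p - t) * g2 (s - i) (p - s) * g1 (p - j) (l - p)
      = (g3 (s + t - i - p) (j + l - p - t) * g1 (p - j) (l - p)) * g2 (s - i) (p - s)"
      by (simp only: mult_ac)
    moreover have "A (s + j - p) = g2 ?X (j + l - p - t) * h1 (p - j) (t - j) * g2 (s - i) (p - s)"
    proof -
      have "j - (s + j - p) = p - s" "s - (s + j - p) = p - j" "l - s - t + (s + j - p) = j + l - p - t" by simp_all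
      then show ?thesis unfolding A_def by (simp only: mult_ac)
    qed
    moreover have "B (s + t - p) = g2 ?X (l - p) * h3 (s + t - i - p) (j - t) * g2 (s - i) (p - s)"
    proof -
      have "t - (s + t - p) = p - s" "s + t - p - i = s + t - i - p" "l - s - t + (s + t - p) = l - p" by simp_all
      then show ?thesis unfolding B_def by (simp only: mult_ac)
    qed
    ultimately show ?thesis unfolding fay e by (simp only: distrib_right)
  qed
  then have R: "(\<Sum>p\<in>idx n. g3 (s + t - i - p) (j + l - p - t) * g2 (s - i) (p - s) * g1 (p - j) (l - p))
      = (\<Sum>p\<in>idx n. A (s + j - p)) + (\<Sum>p\<in>idx n. B (s + t - p))"
    by (simp add: sum.distrib)
  have "A (p mod int n) = A p" "B (p mod int n) = B p" for p
    unfolding A_def B_def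
    by (intro arg_cong2[of _ _ _ _ "(*)"] periodic_cong[where g = g2 and m = "int n", OF per(3,4)] periodic_cong[where g = h1 and m = "int n", OF per(7,8)]
        periodic_cong[where g = h3 and m = "int n", OF per(9,10)]; simp add: mod_simps)+
  then show ?thesis
    unfolding L R by (simp only: sum_idx_reflect[OF n, of A] sum_idx_reflect[OF n, of B])
qed

text \<open>The case t = j, in which the second indices of the two outer factors on each side
  coincide. The assumption \<open>diff\<close> reduces every splitting of \<open>s - i\<close> to a
  fixed one.\<close>

lemma star_triangle_sum_diagonal:
  fixes g1 g2 g3 :: "int \<Rightarrow> int \<Rightarrow> complex"
  assumes n: "n > 0"
    and per: "\<And>a b. g1 (a mod int n) b = g1 a b" "\<And>a b. g1 a (b mod int n) = g1 a b"
      "\<And>a b. g2 (a mod int n) b = g2 a b" "\<And>a b. g2 a (b mod int n) = g2 a b"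
      "\<And>a b. g3 (a mod int n) b = g3 a b" "\<And>a b. g3 a (b mod int n) = g3 a b"
    and diff: "\<And>a a' c c'. a + a' = c + c' \<Longrightarrow>
      \<exists>N. \<forall>b. g3 a b * g1 a' b = g3 c b * g1 c' b + N * g2 (a + a') b"
  shows "(\<Sum>p\<in>idx n. g1 (s - p) (j - p) * g2 (s + j - i - j) (l - s - j + p) * g3 (p - i) (j - p))
    = (\<Sum>p\<in>idx n. g3 (s + j - i - p) (j + l - p - j) * g2 (s - i) (p - s) * g1 (p - j) (l - p))"
proof -
  \<comment> \<open>The reference splitting of \<open>s - i\<close> into 0 and \<open>s - i\<close>,
    independent of \<open>p\<close>; \<open>D\<close> is the right summand after the reflection of
    \<open>p\<close> to \<open>s + j - p\<close>.\<close>
  define G where "G = (\<lambda>b. g3 0 b * g1 (s - i) b)"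
  define D where "D = (\<lambda>p. g3 (p - i) (l - s - j + p) * g2 (s - i) (j - p) * g1 (s - p) (l - s - j + p))"
  have Dper: "D (p mod int n) = D p" for p
    unfolding D_def
    by (intro arg_cong2[of _ _ _ _ "(*)"] periodic_cong[where g = g1 and m = "int n", OF per(1,2)] periodic_cong[where g = g2 and m = "int n", OF per(3,4)]
        periodic_cong[where g = g3 and m = "int n", OF per(5,6)]; simp add: mod_simps)
  have "(\<Sum>p\<in>idx n. g3 (s + j - i - p) (j + l - p - j) * g2 (s - i) (p - s) * g1 (p - j) (l - p))
      = (\<Sum>p\<in>idx n. D (s + j - p))"
    by (rule sum.cong) (simp_all add: D_def algebra_simps)
  also have "\<dots> = (\<Sum>p\<in>idx n. D p)"
    by (rule sum_idx_reflect[where P = D, OF n Dper])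
  finally have R: "(\<Sum>p\<in>idx n. g3 (s + j - i - p) (j + l - p - j) * g2 (s - i) (p - s) * g1 (p - j) (l - p))
      = (\<Sum>p\<in>idx n. D p)" .
  \<comment> \<open>The terms with \<open>N\<close> in the two products are both
    \<open>N * g2 (s - i) (j - p) * g2 (s - i) (l - s - j + p)\<close> and cancel. The rest is
    antisymmetric under exchange of \<open>j - p\<close> and \<open>l - s - j + p\<close>.\<close>
  have key: "g1 (s - p) (j - p) * g2 (s + j - i - j) (l - s - j + p) * g3 (p - i) (j - p) - D p
      = G (j - p) * g2 (s - i) (l - s - j + p) - G (l - s - j + p) * g2 (s - i) (j - p)" for p
  proof -
    obtain N where N: "\<And>b. g3 (p - i) b * g1 (s - p) b = G b + N * g2 (s - i) b"
      using diff[of "p - i" "s - p" 0 "s - i"] by (auto simp: G_def)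
    have "g1 (s - p) (j - p) * g2 (s + j - i - j) (l - s - j + p) * g3 (p - i) (j - p) - D p
      = (g3 (p - i) (j - p) * g1 (s - p) (j - p)) * g2 (s - i) (l - s - j + p)
        - (g3 (p - i) (l - s - j + p) * g1 (s - p) (l - s - j + p)) * g2 (s - i) (j - p)"
      by (simp add: D_def mult_ac)
    also have "\<dots> = G (j - p) * g2 (s - i) (l - s - j + p) - G (l - s - j + p) * g2 (s - i) (j - p)"
      unfolding N by (simp add: algebra_simps)
    finally show ?thesis .
  qed
  define H where "H = (\<lambda>p. G (l - s - j + p) * g2 (s - i) (j - p))"
  have Hper: "H (p mod int n) = H p" for p
    unfolding H_def G_def
    by (intro arg_cong2[of _ _ _ _ "(*)"] periodic_cong[where g = g1 and m = "int n", OF per(1,2)] periodic_cong[where g = g2 and m = "int n", OF per(3,4)]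
        periodic_cong[where g = g3 and m = "int n", OF per(5,6)]; simp add: mod_simps)
  \<comment> \<open>Reflecting \<open>p\<close> to \<open>2 * j + s - l - p\<close> exchanges
    \<open>j - p\<close> and \<open>l - s - j + p\<close>.\<close>
  have "(\<Sum>p\<in>idx n. G (j - p) * g2 (s - i) (l - s - j + p)) = (\<Sum>p\<in>idx n. H ((2 * j + s - l) - p))"
    by (rule sum.cong) (simp_all add: H_def algebra_simps)
  also have "\<dots> = (\<Sum>p\<in>idx n. H p)"
    by (rule sum_idx_reflect[where P = H, OF n Hper])
  finally have "(\<Sum>p\<in>idx n. G (j - p) * g2 (s - i) (l - s - j + p)) - (\<Sum>p\<in>idx n. H p) = 0" by simp
  then have "(\<Sum>p\<in>idx n. g1 (s - p) (j - p) * g2 (s + j - i - j) (l - s - j + p) * g3 (p - i) (j - p) - D p) = 0"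
    unfolding key H_def by (simp add: sum_subtractf)
  then show ?thesis unfolding R by (simp add: sum_subtractf)
qed

section \<open>Matrix coefficients of the two triple products\<close>

lemma sum_idx_congruence:
  assumes "n > 0"
  shows "(\<Sum>b\<in>idx n. if c mod int n = (d + b) mod int n then h b else 0) = (h ((c - d) mod int n) :: complex)"
proof -
  have "c mod int n = (d + b) mod int n \<longleftrightarrow> b = (c - d) mod int n" if "b \<in> idx n" for b
  proof
    assume "c mod int n = (d + b) mod int n"
    then have "(c - d) mod int n = (d + b - d) mod int n" by (intro mod_diff_cong) auto
    then show "b = (c - d) mod int n" using that by (simp add: idx_def)
  qed (simp add: mod_simps)
  then have "(\<Sum>b\<in>idx n. if c mod int n = (d + b) mod int n then h b else 0)
      = (\<Sum>b\<in>idx n. if b = (c - d) mod int n then h b else 0)"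
    by (intro sum.cong) auto
  also have "\<dots> = h ((c - d) mod int n)"
    using assms by (simp add: idx_def)
  finally show ?thesis .
qed

text \<open>Of the six summations over two intermediate triples, the Kronecker deltas of
  \<open>op12\<close> and \<open>op23\<close> remove three.\<close>

lemma mmul_op12_op23_op12:
  assumes "w \<in> idx n" "l \<in> idx n"
  shows "mmul n (mmul n (op12 A) (op23 B)) (op12 C) (s, t, w) (i, j, l)
    = (\<Sum>p\<in>idx n. \<Sum>c\<in>idx n. (\<Sum>b\<in>idx n. A (s, t) (p, b) * B (b, w) (c, l)) * C (p, c) (i, j))"
proof -
  have fin: "finite (idx n)" by (simp add: idx_def)
  have inner: "mmul n (op12 A) (op23 B) (s, t, w) (p, c, m) = (\<Sum>b\<in>idx n. A (s, t) (p, b) * B (b, w) (c, m))"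
    if "p \<in> idx n" for p c m
  proof -
    have "mmul n (op12 A) (op23 B) (s, t, w) (p, c, m)
        = (\<Sum>p'\<in>idx n. \<Sum>b\<in>idx n. \<Sum>m'\<in>idx n. (A (s, t) (p', b) * (if w = m' then 1 else 0))
            * ((if p' = p then 1 else 0) * B (b, m') (c, m)))"
      by (simp add: mmul_def idx3_def op12_def op23_def sum.cartesian_product')
    also have "\<dots> = (\<Sum>p'\<in>idx n. \<Sum>b\<in>idx n. \<Sum>m'\<in>idx n. if w = m' then (if p' = p then A (s, t) (p', b) * B (b, m') (c, m) else 0) else 0)"
      by (intro sum.cong) auto
    also have "\<dots> = (\<Sum>p'\<in>idx n. if p' = p then (\<Sum>b\<in>idx n. A (s, t) (p', b) * B (b, w) (c, m)) else 0)"
      using fin assms(1) by (intro sum.cong) (auto simp: sum.delta)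
    finally show ?thesis using fin that by simp
  qed
  have "mmul n (mmul n (op12 A) (op23 B)) (op12 C) (s, t, w) (i, j, l)
      = (\<Sum>p\<in>idx n. \<Sum>c\<in>idx n. \<Sum>m\<in>idx n. mmul n (op12 A) (op23 B) (s, t, w) (p, c, m) * (C (p, c) (i, j) * (if m = l then 1 else 0)))"
    by (subst mmul_def) (simp add: idx3_def op12_def[of C] sum.cartesian_product')
  also have "\<dots> = (\<Sum>p\<in>idx n. \<Sum>c\<in>idx n. \<Sum>m\<in>idx n. if m = l then (\<Sum>b\<in>idx n. A (s, t) (p, b) * B (b, w) (c, m)) * C (p, c) (i, j) else 0)"
    by (intro sum.cong) (auto simp: inner)
  also have "\<dots> = (\<Sum>p\<in>idx n. \<Sum>c\<in>idx n. (\<Sum>b\<in>idx n. A (s, t) (p, b) * B (b, w) (c, l)) * C (p, c) (i, j))"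
    using fin assms(2) by simp
  finally show ?thesis .
qed

lemma mmul_op23_op12_op23:
  assumes "s \<in> idx n" "i \<in> idx n"
  shows "mmul n (mmul n (op23 A) (op12 B)) (op23 C) (s, t, w) (i, j, l)
    = (\<Sum>p\<in>idx n. \<Sum>d\<in>idx n. (\<Sum>b\<in>idx n. A (t, w) (b, d) * B (s, b) (i, p)) * C (p, d) (j, l))"
proof -
  have fin: "finite (idx n)" by (simp add: idx_def)
  have inner: "mmul n (op23 A) (op12 B) (s, t, w) (m, p, d) = (\<Sum>b\<in>idx n. A (t, w) (b, d) * B (s, b) (m, p))"
    if "d \<in> idx n" for p d m
  proof -
    have "mmul n (op23 A) (op12 B) (s, t, w) (m, p, d)
        = (\<Sum>s'\<in>idx n. \<Sum>b\<in>idx n. \<Sum>d'\<in>idx n. ((if s = s' then 1 else 0) * A (t, w) (b, d'))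
            * (B (s', b) (m, p) * (if d' = d then 1 else 0)))"
      by (simp add: mmul_def idx3_def op12_def op23_def sum.cartesian_product')
    also have "\<dots> = (\<Sum>s'\<in>idx n. \<Sum>b\<in>idx n. \<Sum>d'\<in>idx n. if d' = d then (if s = s' then A (t, w) (b, d') * B (s', b) (m, p) else 0) else 0)"
      by (intro sum.cong) auto
    also have "\<dots> = (\<Sum>s'\<in>idx n. if s = s' then (\<Sum>b\<in>idx n. A (t, w) (b, d) * B (s', b) (m, p)) else 0)"
      using fin that by (intro sum.cong) auto
    finally show ?thesis using fin assms(1) by simp
  qed
  have "mmul n (mmul n (op23 A) (op12 B)) (op23 C) (s, t, w) (i, j, l)
      = (\<Sum>m\<in>idx n. \<Sum>p\<in>idx n. \<Sum>d\<in>idx n. mmul n (op23 A) (op12 B) (s, t, w) (m, p, d) * ((if m = i then 1 else 0) * C (p, d) (j, l)))"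
    by (subst mmul_def) (simp add: idx3_def op23_def[of C] sum.cartesian_product')
  also have "\<dots> = (\<Sum>m\<in>idx n. if m = i then (\<Sum>p\<in>idx n. \<Sum>d\<in>idx n. (\<Sum>b\<in>idx n. A (t, w) (b, d) * B (s, b) (m, p)) * C (p, d) (j, l)) else 0)"
    by (intro sum.cong) (auto simp: inner)
  also have "\<dots> = (\<Sum>p\<in>idx n. \<Sum>d\<in>idx n. (\<Sum>b\<in>idx n. A (t, w) (b, d) * B (s, b) (i, p)) * C (p, d) (j, l))"
    using fin assms(2) by simp
  finally show ?thesis .
qed

text \<open>Each operator preserves the sum of its two indices modulo n. This fixes b = s + t - p
  and c = i + j - p and leaves one summation; the support condition of the middle operator becomes
  conservation of the total index.\<close>

lemma braid_product_12_23_12: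
  assumes n: "n > 0" and idx: "s \<in> idx n" "t \<in> idx n" "w \<in> idx n" "i \<in> idx n" "j \<in> idx n" "l \<in> idx n"
    and per: "\<And>a b. f1 (a mod int n) b = f1 a b" "\<And>a b. f1 a (b mod int n) = f1 a b"
      "\<And>a b. f2 (a mod int n) b = f2 a b" "\<And>a b. f2 a (b mod int n) = f2 a b"
      "\<And>a b. f3 (a mod int n) b = f3 a b" "\<And>a b. f3 a (b mod int n) = f3 a b"
    and A: "\<And>a b i j. \<lbrakk>a \<in> idx n; b \<in> idx n; i \<in> idx n; j \<in> idx n\<rbrakk> \<Longrightarrow>
      A (a, b) (i, j) = (if (a + b) mod int n = (i + j) mod int n then f1 (a - i) (j - a) else 0)"
    and B: "\<And>a b i j. \<lbrakk>a \<in> idx n; b \<in> idx n; i \<in> idx n; j \<in> idx n\<rbrakk> \<Longrightarrow>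
      B (a, b) (i, j) = (if (a + b) mod int n = (i + j) mod int n then f2 (a - i) (j - a) else 0)"
    and C: "\<And>a b i j. \<lbrakk>a \<in> idx n; b \<in> idx n; i \<in> idx n; j \<in> idx n\<rbrakk> \<Longrightarrow>
      C (a, b) (i, j) = (if (a + b) mod int n = (i + j) mod int n then f3 (a - i) (j - a) else 0)"
  shows "mmul n (mmul n (op12 A) (op23 B)) (op12 C) (s, t, w) (i, j, l)
    = (if (s + t + w) mod int n = (i + j + l) mod int n then
        \<Sum>p\<in>idx n. f1 (s - p) (t - p) * f2 (s + t - i - j) (l - s - t + p) * f3 (p - i) (j - p) else 0)"
proof -
  let ?b = "\<lambda>p. (s + t - p) mod int n" and ?c = "\<lambda>p. (i + j - p) mod int n"
  have mem: "c mod int n \<in> idx n" for c using n by (simp add: idx_def)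
  have "mmul n (mmul n (op12 A) (op23 B)) (op12 C) (s, t, w) (i, j, l)
    = (\<Sum>p\<in>idx n. \<Sum>c\<in>idx n. if (i + j) mod int n = (p + c) mod int n then
        (\<Sum>b\<in>idx n. if (s + t) mod int n = (p + b) mod int n then f1 (s - p) (b - s) * B (b, w) (c, l) else 0)
          * f3 (p - i) (j - p) else 0)"
    unfolding mmul_op12_op23_op12[OF idx(3,6)]
    using idx by (intro sum.cong refl) (auto simp: A C intro!: sum.cong)
  also have "\<dots> = (\<Sum>p\<in>idx n. f1 (s - p) (?b p - s) * B (?b p, w) (?c p, l) * f3 (p - i) (j - p))"
    unfolding sum_idx_congruence[OF n] ..
  also have "\<dots> = (\<Sum>p\<in>idx n. if (s + t + w) mod int n = (i + j + l) mod int n then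
       f1 (s - p) (t - p) * f2 (s + t - i - j) (l - s - t + p) * f3 (p - i) (j - p) else 0)"
  proof (intro sum.cong refl)
    fix p assume p: "p \<in> idx n"
    have "(?b p + w) mod int n = (?c p + l) mod int n \<longleftrightarrow> (s + t + w) mod int n = (i + j + l) mod int n"
    proof -
      have "(?b p + w) mod int n = (s + t + w - p) mod int n" "(?c p + l) mod int n = (i + j + l - p) mod int n"
        by (simp_all add: mod_simps algebra_simps)
      moreover have "(s + t + w - p) mod int n = (i + j + l - p) mod int n \<longleftrightarrow> (s + t + w) mod int n = (i + j + l) mod int n"
        by (simp add: mod_eq_dvd_iff algebra_simps)
      ultimately show ?thesis by simp
    qed
    moreover have "f1 (s - p) (?b p - s) = f1 (s - p) (t - p)"
      by (rule periodic_cong[where g = f1 and m = "int n", OF per(1,2)]) (simp_all add: mod_simps)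
    moreover have "f2 (?b p - ?c p) (l - ?b p) = f2 (s + t - i - j) (l - s - t + p)"
      by (rule periodic_cong[where g = f2 and m = "int n", OF per(3,4)], unfold mod_diff_eq, unfold mod_diff_right_eq)
         (simp_all add: algebra_simps)
    ultimately show "f1 (s - p) (?b p - s) * B (?b p, w) (?c p, l) * f3 (p - i) (j - p)
      = (if (s + t + w) mod int n = (i + j + l) mod int n then
       f1 (s - p) (t - p) * f2 (s + t - i - j) (l - s - t + p) * f3 (p - i) (j - p) else 0)"
      using idx mem by (simp add: B)
  qed
  finally show ?thesis by simp
qed

text \<open>The same reduction with b = i + p - s and d = j + l - p. The operators appear in reverse
  order, so that \<open>f1\<close>, \<open>f2\<close>, \<open>f3\<close> keep the meaning they have
  for the other product.\<close>

lemma braid_product_23_12_23: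
  assumes n: "n > 0" and idx: "s \<in> idx n" "t \<in> idx n" "w \<in> idx n" "i \<in> idx n" "j \<in> idx n" "l \<in> idx n"
    and per: "\<And>a b. f1 (a mod int n) b = f1 a b" "\<And>a b. f1 a (b mod int n) = f1 a b"
      "\<And>a b. f2 (a mod int n) b = f2 a b" "\<And>a b. f2 a (b mod int n) = f2 a b"
      "\<And>a b. f3 (a mod int n) b = f3 a b" "\<And>a b. f3 a (b mod int n) = f3 a b"
    and A: "\<And>a b i j. \<lbrakk>a \<in> idx n; b \<in> idx n; i \<in> idx n; j \<in> idx n\<rbrakk> \<Longrightarrow>
      A (a, b) (i, j) = (if (a + b) mod int n = (i + j) mod int n then f1 (a - i) (j - a) else 0)"
    and B: "\<And>a b i j. \<lbrakk>a \<in> idx n; b \<in> idx n; i \<in> idx n; j \<in> idx n\<rbrakk> \<Longrightarrow>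
      B (a, b) (i, j) = (if (a + b) mod int n = (i + j) mod int n then f2 (a - i) (j - a) else 0)"
    and C: "\<And>a b i j. \<lbrakk>a \<in> idx n; b \<in> idx n; i \<in> idx n; j \<in> idx n\<rbrakk> \<Longrightarrow>
      C (a, b) (i, j) = (if (a + b) mod int n = (i + j) mod int n then f3 (a - i) (j - a) else 0)"
  shows "mmul n (mmul n (op23 C) (op12 B)) (op23 A) (s, t, w) (i, j, l)
    = (if (s + t + w) mod int n = (i + j + l) mod int n then
        \<Sum>p\<in>idx n. f3 (s + t - i - p) (j + l - p - t) * f2 (s - i) (p - s) * f1 (p - j) (l - p) else 0)"
proof -
  let ?b = "\<lambda>p. (i + p - s) mod int n" and ?d = "\<lambda>p. (j + l - p) mod int n"
  have mem: "c mod int n \<in> idx n" for c using n by (simp add: idx_def)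
  have "mmul n (mmul n (op23 C) (op12 B)) (op23 A) (s, t, w) (i, j, l)
    = (\<Sum>p\<in>idx n. \<Sum>d\<in>idx n. if (j + l) mod int n = (p + d) mod int n then
        (\<Sum>b\<in>idx n. if (i + p) mod int n = (s + b) mod int n then C (t, w) (b, d) * f2 (s - i) (p - s) else 0)
          * f1 (p - j) (l - p) else 0)"
    unfolding mmul_op23_op12_op23[OF idx(1,4)]
    using idx by (intro sum.cong refl) (auto simp: A B intro!: sum.cong)
  also have "\<dots> = (\<Sum>p\<in>idx n. C (t, w) (?b p, ?d p) * f2 (s - i) (p - s) * f1 (p - j) (l - p))"
    unfolding sum_idx_congruence[OF n] ..
  also have "\<dots> = (\<Sum>p\<in>idx n. if (s + t + w) mod int n = (i + j + l) mod int n then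
       f3 (s + t - i - p) (j + l - p - t) * f2 (s - i) (p - s) * f1 (p - j) (l - p) else 0)"
  proof (intro sum.cong refl)
    fix p assume p: "p \<in> idx n"
    have "(t + w) mod int n = (?b p + ?d p) mod int n \<longleftrightarrow> (s + t + w) mod int n = (i + j + l) mod int n"
    proof -
      have "(?b p + ?d p) mod int n = (i + p - s + (j + l - p)) mod int n"
        by (rule mod_add_eq)
      also have "i + p - s + (j + l - p) = i + j + l - s" by simp
      finally have "(?b p + ?d p) mod int n = (i + j + l - s) mod int n" .
      moreover have "(t + w) mod int n = (i + j + l - s) mod int n \<longleftrightarrow> (s + (t + w)) mod int n = (s + (i + j + l - s)) mod int n"
        by (simp add: mod_eq_dvd_iff algebra_simps)
      ultimately show ?thesis by (simp add: add.assoc)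
    qed
    moreover have "f3 (t - ?b p) (?d p - t) = f3 (s + t - i - p) (j + l - p - t)"
      by (rule periodic_cong[where g = f3 and m = "int n", OF per(5,6)]) (simp_all add: mod_simps algebra_simps)
    ultimately show "C (t, w) (?b p, ?d p) * f2 (s - i) (p - s) * f1 (p - j) (l - p)
      = (if (s + t + w) mod int n = (i + j + l) mod int n then
       f3 (s + t - i - p) (j + l - p - t) * f2 (s - i) (p - s) * f1 (p - j) (l - p) else 0)"
      using idx mem by (simp add: C)
  qed
  finally show ?thesis by simp
qed

subsection \<open>The braid relation\<close>

lemma theta_kron_periodic:
  assumes "0 < Im \<eta>" "n > 0"
  shows "theta_kron n \<eta> (a mod int n) z (k * b) w = theta_kron n \<eta> a z (k * b) w"
    and "theta_kron n \<eta> a z (k * (b mod int n)) w = theta_kron n \<eta> a z (k * b) w"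
proof -
  have *: "theta_kron n \<eta> a z b w = theta_kron n \<eta> a' z b' w"
    if "a mod int n = a' mod int n" "b mod int n = b' mod int n" for a a' b b'
    unfolding theta_kron_def
    using theta_idx_cong[OF assms that(1)] theta_idx_cong[OF assms that(2)]
      theta_idx_cong[OF assms mod_add_cong[OF that]] by simp
  show "theta_kron n \<eta> (a mod int n) z (k * b) w = theta_kron n \<eta> a z (k * b) w"
    by (rule *) simp_all
  show "theta_kron n \<eta> a z (k * (b mod int n)) w = theta_kron n \<eta> a z (k * b) w"
    by (rule *) (simp_all add: mod_mult_right_eq)
qed

text \<open>The output index \<open>a\<close> determines r = j - a modulo n, so at most one summand
  survives. With j - i - r = a - i, the numerator index is (a - i) + k r, the sum of the two
  denominator indices; nonvanishing at \<open>- z\<close> allows completing the punctured product to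
  the full one.\<close>

lemma Rmat_eq_theta_kron:
  fixes z :: complex
  assumes "0 < Im \<eta>" "n > 0" and nz: "\<And>\<beta>. theta_idx n \<eta> \<beta> (- z) \<noteq> 0"
    and mem: "a \<in> idx n" "b \<in> idx n"
  shows "Rmat n k \<eta> \<tau> z (a, b) (i, j) = (if (a + b) mod int n = (i + j) mod int n then
    (\<Prod>\<beta>\<in>idx n. theta_idx n \<eta> \<beta> (- z)) / (\<Prod>\<beta>\<in>{1..<int n}. theta_idx n \<eta> \<beta> 0)
      * theta_kron n \<eta> (a - i) (- z) (k * (j - a)) \<tau> else 0)"
proof -
  define r0 where "r0 = (j - a) mod int n"
  have r0: "r0 \<in> idx n" using assms by (simp add: r0_def idx_def)
  have ja: "(j - r) mod int n = a \<longleftrightarrow> r = r0" if "r \<in> idx n" for r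
  proof
    assume "(j - r) mod int n = a"
    then have "r0 = (j - (j - r)) mod int n" unfolding r0_def by (metis mod_diff_right_eq)
    then show "r = r0" using that by (simp add: idx_def)
  next
    assume "r = r0"
    then show "(j - r) mod int n = a"
      using mem(1) by (simp add: r0_def mod_diff_right_eq idx_def)
  qed
  have ib: "(i + r0) mod int n = b \<longleftrightarrow> (a + b) mod int n = (i + j) mod int n"
  proof -
    have "(i + r0) mod int n = (i + j - a) mod int n"
      by (simp add: r0_def mod_add_right_eq add_diff_eq)
    moreover have "b = b mod int n" using mem by (simp add: idx_def)
    ultimately have "(i + r0) mod int n = b \<longleftrightarrow> (i + j - a) mod int n = b mod int n" by simp
    also have "\<dots> \<longleftrightarrow> (a + b) mod int n = (i + j) mod int n"
      by (subst eq_commute) (simp add: mod_eq_dvd_iff algebra_simps)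
    finally show ?thesis .
  qed
  have set: "{r \<in> idx n. (j - r) mod int n = a \<and> (i + r) mod int n = b}
      = (if (a + b) mod int n = (i + j) mod int n then {r0} else {})"
    using ja r0 ib by auto
  have c1: "(j - i - r0) mod int n = (a - i) mod int n"
  proof -
    have "(j - i - r0) mod int n = (j - i - (j - a)) mod int n"
      unfolding r0_def by (rule mod_diff_right_eq)
    then show ?thesis by simp
  qed
  have c2: "(k * r0) mod int n = (k * (j - a)) mod int n"
    unfolding r0_def by (rule mod_mult_right_eq)
  have c3: "(j - i + r0 * (k - 1)) mod int n = (a - i + k * (j - a)) mod int n"
    using mod_add_cong[OF c1 c2] by (simp add: algebra_simps)
  have fin: "finite (idx n)" by (simp add: idx_def)
  have "(\<Prod>\<beta>\<in>idx n. theta_idx n \<eta> \<beta> (- z))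
      = theta_idx n \<eta> ((j - i - r0) mod int n) (- z) * (\<Prod>\<beta>\<in>idx n - {(j - i - r0) mod int n}. theta_idx n \<eta> \<beta> (- z))"
    by (rule prod.remove[OF fin]) (use assms(2) in \<open>simp add: idx_def\<close>)
  also have "theta_idx n \<eta> ((j - i - r0) mod int n) (- z) = theta_idx n \<eta> (a - i) (- z)"
    by (rule theta_idx_cong[OF assms(1,2)]) (simp add: c1)
  finally have P: "(\<Prod>\<beta>\<in>idx n - {(j - i - r0) mod int n}. theta_idx n \<eta> \<beta> (- z))
      = (\<Prod>\<beta>\<in>idx n. theta_idx n \<eta> \<beta> (- z)) / theta_idx n \<eta> (a - i) (- z)"
    using nz by (simp add: field_simps)
  show ?thesis
    unfolding Rmat_def Let_def prod.case set
    by (simp add: P theta_kron_def theta_idx_cong[OF assms(1,2) c2] theta_idx_cong[OF assms(1,2) c3] mult_ac)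
qed

text \<open>A zero at 0 would have q = 0 because \<eta> is not real, forcing n to divide \<alpha>.
  This keeps Fay's identity nondegenerate when both second complex arguments equal \<tau> but the
  indices differ.\<close>

lemma theta_idx_0_nonzero:
  assumes "0 < Im \<eta>" "n > 0" "\<not> int n dvd \<alpha>"
  shows "theta_idx n \<eta> \<alpha> 0 \<noteq> 0"
proof
  assume "theta_idx n \<eta> \<alpha> 0 = 0"
  then obtain p q :: int where pq: "0 = (of_int p + of_int q * \<eta>) / of_nat n" "int n dvd (q + \<alpha>)"
    using theta_idx_eq_0D[OF assms(1,2)] by blast
  then have "Im (of_int p + of_int q * \<eta>) = 0" using assms(2) by simp
  then have "q = 0" using assms(1) by simp
  with pq(2) assms(3) show False by simp
qed

lemma Rmat_braid_relation_generic:
  fixes u v :: complex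
  assumes "0 < Im \<eta>" "n > 0" "coprime k (int n)"
    and nz: "\<And>\<beta>. theta_idx n \<eta> \<beta> (- u) \<noteq> 0" "\<And>\<beta>. theta_idx n \<eta> \<beta> (- (u + v)) \<noteq> 0"
      "\<And>\<beta>. theta_idx n \<eta> \<beta> (- v) \<noteq> 0" "\<And>\<beta>. theta_idx n \<eta> \<beta> \<tau> \<noteq> 0"
    and mem: "x \<in> idx3 n" "y \<in> idx3 n"
  shows "mmul n (mmul n (op12 (Rmat n k \<eta> \<tau> u)) (op23 (Rmat n k \<eta> \<tau> (u + v)))) (op12 (Rmat n k \<eta> \<tau> v)) x y
   = mmul n (mmul n (op23 (Rmat n k \<eta> \<tau> v)) (op12 (Rmat n k \<eta> \<tau> (u + v)))) (op23 (Rmat n k \<eta> \<tau> u)) x y"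
proof -
  \<comment> \<open>The scalar in front of each operator; both sides of the relation carry the same
    product \<open>c u * c (u + v) * c v\<close>.\<close>
  define c where "c = (\<lambda>z. (\<Prod>\<beta>\<in>idx n. theta_idx n \<eta> \<beta> (- z)) / (\<Prod>\<beta>\<in>{1..<int n}. theta_idx n \<eta> \<beta> 0))"
  define g where "g = (\<lambda>z a b. theta_kron n \<eta> a (- z) (k * b) \<tau>)"
  define h where "h = (\<lambda>z a b. theta_kron n \<eta> a (- z) (k * b) 0)"
  define f where "f = (\<lambda>z a b. c z * g z a b)"
  obtain s t w i j l where xy: "x = (s, t, w)" "y = (i, j, l)" by (metis prod_cases3)
  with mem have idx: "s \<in> idx n" "t \<in> idx n" "w \<in> idx n" "i \<in> idx n" "j \<in> idx n" "l \<in> idx n"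
    by (auto simp: idx3_def)
  have gper: "g z (a mod int n) b = g z a b" "g z a (b mod int n) = g z a b" for z a b
    unfolding g_def by (rule theta_kron_periodic[OF assms(1,2)])+
  have hper: "h z (a mod int n) b = h z a b" "h z a (b mod int n) = h z a b" for z a b
    unfolding h_def by (rule theta_kron_periodic[OF assms(1,2)])+
  have fper: "f z (a mod int n) b = f z a b" "f z a (b mod int n) = f z a b" for z a b
    by (simp_all add: f_def gper)
  have R: "Rmat n k \<eta> \<tau> z (a, b) (i, j) = (if (a + b) mod int n = (i + j) mod int n then f z (a - i) (j - a) else 0)"
    if "z \<in> {u, u + v, v}" "a \<in> idx n" "b \<in> idx n" for z a b i j
  proof -
    have "theta_idx n \<eta> \<beta> (- z) \<noteq> 0" for \<beta> using that(1) nz by blast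
    from Rmat_eq_theta_kron[OF assms(1,2) this that(2,3)] show ?thesis
      by (simp add: f_def c_def g_def)
  qed
  have sum: "- v + - u = - (u + v)" by simp
  have star: "(\<Sum>p\<in>idx n. g u (s - p) (t - p) * g (u + v) (s + t - i - j) (l - s - t + p) * g v (p - i) (j - p))
    = (\<Sum>p\<in>idx n. g v (s + t - i - p) (j + l - p - t) * g (u + v) (s - i) (p - s) * g u (p - j) (l - p))"
  proof (cases "j mod int n = t mod int n")
    case True
    then have "t = j" using idx by (simp add: idx_def)
    have diff: "\<exists>N. \<forall>b. g v a b * g u a' b = g v d b * g u d' b + N * g (u + v) (a + a') b"
      if "a + a' = d + d'" for a a' d d'
      using theta_kron_product_difference[OF assms(1,2) refl that[symmetric] sum nz(3,1,3,1,2)] nz(4)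
      unfolding g_def by metis
    show ?thesis unfolding \<open>t = j\<close>
      by (rule star_triangle_sum_diagonal[where ?g1.0 = "g u" and ?g2.0 = "g (u + v)" and ?g3.0 = "g v", OF assms(2) gper gper gper diff])
  next
    case False
    have fay: "g v a b * g u a' b' = g (u + v) (a + a') b * h u a' (b' - b) + g (u + v) (a + a') b' * h v a (b - b')"
      if "b mod int n \<noteq> b' mod int n" for a a' b b'
    proof -
      \<comment> \<open>Multiplication by \<open>k\<close> is injective modulo n by coprimality, so
        distinct residues stay distinct.\<close>
      have "\<not> int n dvd k * b' - k * b"
      proof
        assume "int n dvd k * b' - k * b"
        then have "int n dvd k * (b' - b)" by (simp add: right_diff_distrib)
        then have "int n dvd b' - b"
          using assms(3) by (simp add: coprime_commute coprime_dvd_mult_right_iff)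
        then show False using that by (metis mod_eq_dvd_iff)
      qed
      then have "theta_idx n \<eta> (k * b' - k * b) (\<tau> - \<tau>) \<noteq> 0"
        using theta_idx_0_nonzero[OF assms(1,2)] by simp
      from theta_kron_fay[OF assms(1,2) nz(3,1) _ nz(4,4) this, of a a']
      show ?thesis
        unfolding g_def h_def sum using nz(2) by (simp only: right_diff_distrib diff_self) simp
    qed
    show ?thesis
      by (rule star_triangle_sum_generic[where ?g1.0 = "g u" and ?g2.0 = "g (u + v)" and ?g3.0 = "g v"
            and ?h1.0 = "h u" and ?h3.0 = "h v", OF assms(2) gper gper gper hper hper fay False])
  qed
  have "mmul n (mmul n (op12 (Rmat n k \<eta> \<tau> u)) (op23 (Rmat n k \<eta> \<tau> (u + v)))) (op12 (Rmat n k \<eta> \<tau> v)) (s, t, w) (i, j, l)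
    = (if (s + t + w) mod int n = (i + j + l) mod int n then
        \<Sum>p\<in>idx n. f u (s - p) (t - p) * f (u + v) (s + t - i - j) (l - s - t + p) * f v (p - i) (j - p) else 0)"
    by (rule braid_product_12_23_12[where ?f1.0 = "f u" and ?f2.0 = "f (u + v)" and ?f3.0 = "f v", OF assms(2) idx fper fper fper]) (simp_all add: R)
  also have "(\<Sum>p\<in>idx n. f u (s - p) (t - p) * f (u + v) (s + t - i - j) (l - s - t + p) * f v (p - i) (j - p))
    = c u * c (u + v) * c v * (\<Sum>p\<in>idx n. g u (s - p) (t - p) * g (u + v) (s + t - i - j) (l - s - t + p) * g v (p - i) (j - p))"
    unfolding sum_distrib_left f_def by (intro sum.cong refl) (simp only: mult_ac)
  also have "\<dots> = (\<Sum>p\<in>idx n. f v (s + t - i - p) (j + l - p - t) * f (u + v) (s - i) (p - s) * f u (p - j) (l - p))"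
    unfolding star sum_distrib_left f_def by (intro sum.cong refl) (simp only: mult_ac)
  also have "(if (s + t + w) mod int n = (i + j + l) mod int n then \<dots> else 0) =
    mmul n (mmul n (op23 (Rmat n k \<eta> \<tau> v)) (op12 (Rmat n k \<eta> \<tau> (u + v)))) (op23 (Rmat n k \<eta> \<tau> u)) (s, t, w) (i, j, l)"
    by (rule braid_product_23_12_23[where ?f1.0 = "f u" and ?f2.0 = "f (u + v)" and ?f3.0 = "f v", OF assms(2) idx fper fper fper, symmetric]) (simp_all add: R)
  finally show ?thesis unfolding xy .
qed

section \<open>Continuity and the exceptional parameters\<close>

lemma continuous_on_Rmat:
  assumes "0 < Im \<eta>" "continuous_on S f"
  shows "continuous_on S (\<lambda>x. Rmat n k \<eta> \<tau> (f x) ab ij)"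
proof -
  have jt: "continuous_on S (\<lambda>x. jtheta \<eta> (g x))" if "continuous_on S g" for g
    using continuous_on_compose2[OF continuous_on_jtheta_UNIV[OF assms(1)] that] by simp
  \<comment> \<open>The divisors are theta values at 0 and at \<tau>, constant in \<open>x\<close>,
    so no quotient of varying functions occurs.\<close>
  show ?thesis
    unfolding Rmat_def Let_def case_prod_unfold theta_idx_def divide_inverse
    by (intro continuous_intros jt assms(2))
qed

lemma continuous_on_mmul:
  assumes "\<And>x y. continuous_on S (\<lambda>e. A e x y)" "\<And>x y. continuous_on S (\<lambda>e. B e x y)"
  shows "continuous_on S (\<lambda>e. mmul n (A e) (B e) x y)"
  unfolding mmul_def by (intro continuous_intros assms)

lemma continuous_on_op12_op23:
  assumes "\<And>ab ij. continuous_on S (\<lambda>e. A e ab ij)"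
  shows "continuous_on S (\<lambda>e. op12 (A e) x y)" "continuous_on S (\<lambda>e. op23 (A e) x y)"
  unfolding op12_def op23_def Let_def case_prod_unfold by (intro continuous_intros assms)+

text \<open>The set where \<open>f\<close> does not vanish is open, and a nonempty open set of reals
  is uncountable, so it cannot lie inside \<open>S\<close>.\<close>

lemma continuous_eq_0_of_cocountable:
  fixes f :: "real \<Rightarrow> complex"
  assumes "continuous_on UNIV f" "countable S" "\<And>x. x \<notin> S \<Longrightarrow> f x = 0"
  shows "f x = 0"
proof (rule ccontr)
  assume "f x \<noteq> 0"
  moreover have "open {x. f x \<noteq> 0}"
    by (intro open_Collect_neq assms continuous_intros)
  ultimately obtain y where "y \<in> {x. f x \<noteq> 0}" "y \<notin> S"
    using open_minus_countable[OF assms(2), of "{x. f x \<noteq> 0}"] by blast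
  with assms(3) show False by blast
qed

theorem theorem3p7:
  fixes n :: nat and k :: int and \<eta> \<tau> u v :: complex
  assumes "0 < Im \<eta>"
    and "1 \<le> k" and "k < int n" and "coprime k (int n)"
    and "\<forall>p q :: int. \<tau> \<noteq> (of_int p + of_int q * \<eta>) / of_nat n"
  shows "\<forall>x\<in>idx3 n. \<forall>y\<in>idx3 n.
     mmul n (mmul n (op12 (Rmat n k \<eta> \<tau> u)) (op23 (Rmat n k \<eta> \<tau> (u + v))))
            (op12 (Rmat n k \<eta> \<tau> v)) x y
   = mmul n (mmul n (op23 (Rmat n k \<eta> \<tau> v)) (op12 (Rmat n k \<eta> \<tau> (u + v))))
            (op23 (Rmat n k \<eta> \<tau> u)) x y"
proof (intro ballI)
  fix x y assume xy: "x \<in> idx3 n" "y \<in> idx3 n"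
  have n: "n > 0" using assms by linarith
  have \<tau>: "theta_idx n \<eta> \<beta> \<tau> \<noteq> 0" for \<beta>
    using theta_idx_eq_0D[OF assms(1) n] assms(5) by blast
  \<comment> \<open>A countable set containing every \<open>z\<close> at which some theta_alpha(- z)
    vanishes.\<close>
  define bad where "bad = range (\<lambda>(p :: int, q :: int). (of_int p + of_int q * \<eta>) / of_nat n)"
  have good: "theta_idx n \<eta> \<beta> (- z) \<noteq> 0" if "z \<notin> bad" for z \<beta>
  proof
    assume "theta_idx n \<eta> \<beta> (- z) = 0"
    then obtain p q :: int where "- z = (of_int p + of_int q * \<eta>) / of_nat n"
      using theta_idx_eq_0D[OF assms(1) n] by blast
    then have "z = (of_int (- p) + of_int (- q) * \<eta>) / of_nat n"
      by (metis (no_types, lifting) add.inverse_inverse minus_add_distrib minus_divide_left minus_mult_left of_int_minus)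
    then have "z \<in> bad" unfolding bad_def by (intro image_eqI[of _ _ "(- p, - q)"]) auto
    with that show False by contradiction
  qed
  \<comment> \<open>Both parameters move along the real direction, so their sum moves by
    \<open>2 * \<epsilon>\<close>. All three arguments are injective in \<open>\<epsilon>\<close>
    and hence meet \<open>bad\<close> for only countably many values.\<close>
  define U where "U = (\<lambda>\<epsilon>::real. u + of_real \<epsilon>)"
  define V where "V = (\<lambda>\<epsilon>::real. v + of_real \<epsilon>)"
  define D where "D = (\<lambda>\<epsilon>.
     mmul n (mmul n (op12 (Rmat n k \<eta> \<tau> (U \<epsilon>))) (op23 (Rmat n k \<eta> \<tau> (U \<epsilon> + V \<epsilon>)))) (op12 (Rmat n k \<eta> \<tau> (V \<epsilon>))) x y
   - mmul n (mmul n (op23 (Rmat n k \<eta> \<tau> (V \<epsilon>))) (op12 (Rmat n k \<eta> \<tau> (U \<epsilon> + V \<epsilon>)))) (op23 (Rmat n k \<eta> \<tau> (U \<epsilon>))) x y)"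
  have "D 0 = 0"
  proof (rule continuous_eq_0_of_cocountable)
    show "continuous_on UNIV D"
      unfolding D_def U_def V_def
      by (intro continuous_on_diff continuous_on_mmul continuous_on_op12_op23 continuous_on_Rmat assms(1) continuous_intros)
    have "countable bad" unfolding bad_def by simp
    moreover have "inj U" "inj V" "inj (\<lambda>\<epsilon>. U \<epsilon> + V \<epsilon>)"
      by (auto simp: inj_def U_def V_def complex_eq_iff)
    moreover have "countable (W -` bad)" if "countable bad" "inj W" for W :: "real \<Rightarrow> complex"
      using countable_image_inj_on[of W "W -` bad"] countable_subset[of "W ` (W -` bad)" bad] that
      by (auto intro: inj_on_subset)
    ultimately show "countable (U -` bad \<union> V -` bad \<union> (\<lambda>\<epsilon>. U \<epsilon> + V \<epsilon>) -` bad)"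
      by simp
    fix \<epsilon> assume "\<epsilon> \<notin> U -` bad \<union> V -` bad \<union> (\<lambda>\<epsilon>. U \<epsilon> + V \<epsilon>) -` bad"
    then show "D \<epsilon> = 0"
      using Rmat_braid_relation_generic[OF assms(1) n assms(4) good good good \<tau> xy, of "U \<epsilon>" "V \<epsilon>"]
      by (simp add: D_def)
  qed
  then show "mmul n (mmul n (op12 (Rmat n k \<eta> \<tau> u)) (op23 (Rmat n k \<eta> \<tau> (u + v)))) (op12 (Rmat n k \<eta> \<tau> v)) x y
   = mmul n (mmul n (op23 (Rmat n k \<eta> \<tau> v)) (op12 (Rmat n k \<eta> \<tau> (u + v)))) (op23 (Rmat n k \<eta> \<tau> u)) x y"
    by (simp add: D_def U_def V_def)
qed

end
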